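(* Let $p\ge 1$ and let $G=\mathrm{SO}(n)$. Then $$H(F_n(\mathfrak N_p)^{\mathrm{SO}(n)},t)=\frac{p(t)}{1-t^2},$$ where $p(t)$ is a polynomial (not to be confused with the integer $p$) such that $\deg p(t)\le n(p-1)$.
   Context: $V$ is a finite-dimensional vector space over $\mathbb C$ with basis $X=\{x_1,\dots,x_n\}$, and $\mathbb C\langle X\rangle$ is the free associative algebra on $X$, identified with the tensor algebra $T(V)$. Left-normed commutators: $[u_1,u_2]=u_1u_2-u_2u_1$ and $[u_1,\dots,u_i]=[[u_1,\dots,u_{i-1}],u_i]$ for $i\ge 3$. For $m\ge 2$, $I_m$ is the two-sided ideal of $\mathbb C\langle X\rangle$ generated by all commutators $[u_1,\dots,u_m]$ with $u_1,\dots,u_m\in\mathbb C\langle X\rangle$, and $F_n(\mathfrak N_p)=\mathbb C\langle X\rangle/I_{p+1}$. $\mathrm{GL}(n)=\mathrm{GL}(V,\mathbb C)$ acts on $V$ and, diagonally by algebra automorphisms, on $\mathbb C\langle X\rangle$ and on the quotient $F_n(\mathfrak N_p)$. $\mathrm{SO}(n)=\mathrm{SO}(V,\mathbb C)$ is the subgroup of determinant-one elements preserving the non-degenerate symmetric bilinear form on $V$ for which $X$ is an orthonormal basis. $F_n(\mathfrak N_p)$ is graded by total degree (each $x_i$ of degree $1$), with homogeneous components $F_n^{(i)}(\mathfrak N_p)$, and $H(F_n(\mathfrak N_p)^G,t)=\sum_{i\ge0}\dim_{\mathbb C}\big(F_n^{(i)}(\mathfrak N_p)^G\big)t^i$ is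 the Hilbert series.
   Formalization: The cases n=1, p=1 and n=0 are excluded, since the degree bound fails there: for n=p=1, H=1/(1-t)=(1+t)/(1-t^2) has numerator of degree 1>0; for n=0, H=1 has numerator 1-t^2 of degree 2>0. *)

theory Defs
  imports
    "HOL-Analysis.Analysis"
    "HOL-Library.Poly_Mapping"
    "HOL-Algebra.QuotRing"
    "HOL-Algebra.Embedded_Algebras"
    "HOL-Computational_Algebra.Polynomial_FPS"
begin

text \<open>
  The free associative algebra on \<open>{x\<^sub>j | j :: 'n}\<close> is the monoid algebra over \<open>\<complex>\<close> of the free
  monoid on \<open>'n\<close>. The multiplication of \<^typ>\<open>'a \<Rightarrow>\<^sub>0 'b\<close> is convolution with respect to an
  additively written monoid, so concatenation of words is written \<open>+\<close> and the empty word \<open>0\<close>;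
  lists are wrapped in order not to instantiate the list type itself.
\<close>

datatype 'n word = Word (letters: "'n list")

instantiation word :: (type) monoid_add
begin

definition zero_word :: "'a word"
  where "0 = Word []"

definition plus_word :: "'a word \<Rightarrow> 'a word \<Rightarrow> 'a word"
  where "u + v = Word (letters u @ letters v)"

instance
  by standard (simp_all add: zero_word_def plus_word_def)

end

type_synonym 'n free_algebra = "'n word \<Rightarrow>\<^sub>0 complex"

definition const :: "complex \<Rightarrow> 'n free_algebra"
  where "const c = Poly_Mapping.single 0 c"

definition gen :: "'n \<Rightarrow> 'n free_algebra"
  where "gen j = Poly_Mapping.single (Word [j]) 1"

definition homogeneous :: "nat \<Rightarrow> 'n free_algebra \<Rightarrow> bool"
  where "homogeneous i f \<longleftrightarrow> (\<forall>w \<in> Poly_Mapping.keys f. length (letters w) = i)"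

definition free_ring :: "'n free_algebra ring"
  where "free_ring = \<lparr>carrier = UNIV, mult = (*), one = 1, zero = 0, add = (+)\<rparr>"

definition commutator :: "'a::ring \<Rightarrow> 'a \<Rightarrow> 'a"
  where "commutator u v = u * v - v * u"

definition left_normed :: "'a::ring list \<Rightarrow> 'a"
  where "left_normed us = foldl commutator (hd us) (tl us)"

definition lie_ideal :: "nat \<Rightarrow> 'n free_algebra set"
  where "lie_ideal m = genideal free_ring {left_normed us | us. length us = m}"

definition coset :: "nat \<Rightarrow> 'n free_algebra \<Rightarrow> 'n free_algebra set"
  where "coset p f = lie_ideal (p + 1) +>\<^bsub>free_ring\<^esub> f"

definition rel_free :: "nat \<Rightarrow> 'n free_algebra set ring"
  where "rel_free p = free_ring Quot lie_ideal (p + 1)"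

definition scalars :: "nat \<Rightarrow> 'n free_algebra set set"
  where "scalars p = range (\<lambda>c. coset p (const c))"

definition component :: "nat \<Rightarrow> nat \<Rightarrow> 'n free_algebra set set"
  where "component p i = coset p ` {f. homogeneous i f}"

text \<open>
  \<open>V\<close> is \<^typ>\<open>complex ^ 'n\<close> with \<open>x\<^sub>j = axis j 1\<close>, on which matrices act by \<open>*v\<close>. The library's
  inner product on this type is the real one, so the complex bilinear form is written out.
\<close>

definition bilin :: "complex ^ 'n \<Rightarrow> complex ^ 'n \<Rightarrow> complex"
  where "bilin u v = (\<Sum>j\<in>UNIV. u $ j * v $ j)"

definition SO :: "(complex ^ 'n ^ 'n) set"
  where "SO = {A. (\<forall>u v. bilin (A *v u) (A *v v) = bilin u v) \<and> det A = 1}"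

definition embed :: "complex ^ 'n \<Rightarrow> 'n free_algebra"
  where "embed v = (\<Sum>j\<in>UNIV. const (v $ j) * gen j)"

text \<open>The algebra endomorphism of the free algebra with \<open>x\<^sub>j \<mapsto> A x\<^sub>j\<close>.\<close>

definition act :: "complex ^ 'n ^ 'n \<Rightarrow> 'n free_algebra \<Rightarrow> 'n free_algebra"
  where "act A f = (\<Sum>w\<in>Poly_Mapping.keys f.
    const (Poly_Mapping.lookup f w) * prod_list (map (\<lambda>j. embed (A *v axis j 1)) (letters w)))"

text \<open>
  For invertible \<open>A\<close>, \<open>act A\<close> is an automorphism preserving the ideal, so the induced action sends
  the coset of \<open>f\<close> to the coset of \<open>act A f\<close>, which is the image of the coset under \<open>act A\<close>.
\<close>

definition invariants :: "(complex ^ 'n ^ 'n) set \<Rightarrow> nat \<Rightarrow> 'n free_algebra set set"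
  where "invariants G p = {C \<in> carrier (rel_free p). \<forall>A\<in>G. act A ` C = C}"

text \<open>
  The dimension is taken over the image of \<open>\<complex>\<close> in the quotient, which is a copy of \<open>\<complex>\<close> because
  the ideal contains no nonzero constants.
\<close>

definition hilbert_series :: "(complex ^ 'n ^ 'n) set \<Rightarrow> nat \<Rightarrow> rat fps"
  where "hilbert_series G p =
    Abs_fps (\<lambda>i. of_nat (ring.dim (rel_free p) (scalars p) (component p i \<inter> invariants G p)))"

end

theory Submission
  imports Defs
begin

text \<open>
  It suffices that the Laplacian \<open>\<Delta>\<close> maps the invariants of degree \<open>i\<close> bijectively onto those of
  degree \<open>i - 2\<close> for \<open>i > n (p - 1)\<close>. The partial derivatives act on the relatively free algebra and
  make it, up to a filtration, a polynomial algebra over the common kernel \<open>B\<close> of the derivatives.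
  Surjectivity of \<open>\<Delta>\<close> holds in all degrees, because \<open>\<Delta> r\<^sup>2\<close> is invertible by the classical
  commutation relation of \<open>\<Delta>\<close>, \<open>r\<^sup>2\<close> and the Euler operator. For injectivity let \<open>u\<close> be a harmonic
  invariant of polynomial degree \<open>k\<close>. Some isotropic direction \<open>y\<close> has \<open>\<partial>\<^sub>y\<^sup>k u \<noteq> 0\<close>. In a basis
  containing \<open>y\<close> and \<open>\<bar>y\<close>, a torus of the orthogonal group shows that the degrees of \<open>u\<close> in
  the two corresponding variables agree, and \<open>\<partial>\<^sub>y\<^sup>k\<close> lowers only one of them. Elements of \<open>B\<close> have
  degree at most \<open>p - 1\<close> in every variable, since a product containing \<open>p\<close> commutators with the same
  variable is zero, so \<open>u\<close> has degree at most \<open>n (p - 1)\<close>.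
\<close>

section \<open>Products with many commutators in Lie nilpotent quotients\<close>

text \<open>The coefficients in \<open>B\<close> have bounded degree, so the obstacle is the
  polynomial degree k, which a priori grows with i. Isotropic directions are chosen for two reasons.
  A harmonic polynomial is determined by its restriction to the isotropic cone, so the top
  derivative can be detected along such a direction. And an isotropic vector and its conjugate form
  a hyperbolic pair: scaling one by t and the other by 1/t is orthogonal of determinant one, so
  their two variables occur equally often in an invariant. After k derivatives along one of them the
  partner variable has kept its full degree; bounding that degree therefore bounds the degree in the
  differentiated variable as it was before, whatever k is.

  The splitting over \<open>B\<close> is never constructed. All arguments concern representatives in
  the free algebra modulo an ideal \<open>J\<close> stable under derivatives and linear
  substitutions; \<open>B\<close> appears as the elements whose derivatives all lie in
  \<open>J\<close>. In one variable there are no isotropic vectors, and that case is treated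
  separately.\<close>

locale ring_ideal =
  fixes J :: "'a::ring_1 set"
  assumes zero_mem: "0 \<in> J"
    and add_mem: "f \<in> J \<Longrightarrow> g \<in> J \<Longrightarrow> f + g \<in> J"
    and lmult_mem: "f \<in> J \<Longrightarrow> g * f \<in> J"
    and rmult_mem: "f \<in> J \<Longrightarrow> f * g \<in> J"
begin

lemma uminus_mem: "f \<in> J \<Longrightarrow> - f \<in> J"
  using lmult_mem[of f "-1"] by simp

lemma diff_mem: "f \<in> J \<Longrightarrow> g \<in> J \<Longrightarrow> f - g \<in> J"
  using add_mem[OF _ uminus_mem, of f g] by simp

lemma sum_mem: "(\<And>i. i \<in> S \<Longrightarrow> f i \<in> J) \<Longrightarrow> sum f S \<in> J"
  by (induction S rule: infinite_finite_induct) (simp_all add: zero_mem add_mem)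

end

lemma left_normed_Cons: "left_normed (u # us) = foldl commutator u us"
  by (simp add: left_normed_def)

lemma left_normed_snoc: "us \<noteq> [] \<Longrightarrow> left_normed (us @ [u]) = commutator (left_normed us) u"
  by (cases us) (simp_all add: left_normed_def)

lemma commutator_add_left: "commutator (u + u') v = commutator u v + commutator u' v"
  by (simp add: commutator_def algebra_simps)

text \<open>Folding it along a list gives the nested elements
  \<open>[...[[c, x] v_1, x] v_2 ..., x] v_k\<close>, the form in which commutators with the same
  \<open>x\<close> accumulate.\<close>

definition twisted_step :: "'a \<Rightarrow> 'a \<Rightarrow> 'a \<Rightarrow> 'a::ring_1"
  where "twisted_step x c v = commutator c x * v"

lemma foldl_twisted_step_diff:
  "foldl (twisted_step x) (c - d) vs = foldl (twisted_step x) c vs - foldl (twisted_step x) d vs"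
proof (induction vs arbitrary: c d)
  case (Cons v vs)
  have "twisted_step x (c - d) v = twisted_step x c v - twisted_step x d v"
    by (simp add: twisted_step_def commutator_def algebra_simps)
  with Cons show ?case by simp
qed simp

lemma foldl_twisted_step_add:
  "foldl (twisted_step x) (c + d) vs = foldl (twisted_step x) c vs + foldl (twisted_step x) d vs"
  using foldl_twisted_step_diff[of x c "- d" vs] foldl_twisted_step_diff[of x 0 d vs]
    foldl_twisted_step_diff[of x 0 0 vs] by simp

text \<open>\<open>x\<close> commutes with itself, so as a left factor it passes out of every
  \<open>[_, x] v\<close>.\<close>

lemma foldl_twisted_step_mult: "foldl (twisted_step x) (x * c) vs = x * foldl (twisted_step x) c vs"
proof (induction vs arbitrary: c)
  case (Cons v vs)
  have "twisted_step x (x * c) v = x * twisted_step x c v"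
    by (simp add: twisted_step_def commutator_def algebra_simps)
  with Cons show ?case by simp
qed simp

text \<open>Rung k consists of sums of elements reached by k maps \<open>f |-> [f, x] r\<close> from
  arbitrary elements. It counts the commutators with \<open>x\<close> collected so far;
  \<open>ladder_mem\<close> shows that p rungs lead into the ideal.\<close>

inductive ladder :: "'a::ring_1 \<Rightarrow> nat \<Rightarrow> 'a \<Rightarrow> bool" for x
  where
    ladder_0: "ladder x 0 f"
  | ladder_step: "ladder x k f \<Longrightarrow> ladder x (Suc k) (commutator f x * r)"
  | ladder_add: "ladder x k f \<Longrightarrow> ladder x k g \<Longrightarrow> ladder x k (f + g)"

lemma ladder_rmult: "ladder x k f \<Longrightarrow> ladder x k (f * r)"
  by (induction rule: ladder.induct)
    (auto simp: mult.assoc distrib_right intro: ladder.intros)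

lemma ladder_commutator: "ladder x k f \<Longrightarrow> ladder x (Suc k) (commutator f x)"
  using ladder_step[of x k f 1] by simp

lemma ladder_zero: "ladder x k 0"
proof -
  have "\<exists>f. ladder x k f"
    by (induction k) (auto intro: ladder_0 ladder_commutator)
  then show ?thesis using ladder_rmult[of x k _ 0] by auto
qed

context ring_ideal
begin

text \<open>
  Since \<open>[c, x] v = [c, x v] - x [c, v]\<close> and \<open>c \<mapsto> [c, x] v\<close> commutes with left multiplication
  by \<open>x\<close>, the twisted steps can be traded one by one for commutators.
\<close>

lemma foldl_twisted_step_mem:
  assumes "\<And>us. length us = p + 1 \<Longrightarrow> left_normed us \<in> J"
    and "length bs + length vs = p"
  shows "foldl (twisted_step x) (foldl commutator u bs) vs \<in> J"
  using assms(2)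
proof (induction vs arbitrary: bs)
  case Nil
  then show ?case using assms(1)[of "u # bs"] by (simp add: left_normed_Cons)
next
  case (Cons v vs)
  let ?c = "foldl commutator u bs"
  have "twisted_step x ?c v = commutator ?c (x * v) - x * commutator ?c v"
    by (simp add: twisted_step_def commutator_def algebra_simps)
  moreover have "foldl (twisted_step x) (foldl commutator u (bs @ [w])) vs \<in> J" for w
    using Cons by (intro Cons.IH) simp
  ultimately show ?case
    by (simp add: foldl_twisted_step_diff foldl_twisted_step_mult diff_mem lmult_mem)
qed

lemma ladder_mem:
  assumes "\<And>us. length us = p + 1 \<Longrightarrow> left_normed us \<in> J"
    and "ladder x k f" "p \<le> k"
  shows "f \<in> J"
proof -
  \<comment> \<open>Generalised over the steps still to come: undoing the last rung
    \<open>[f, x] r\<close> puts \<open>r\<close> in front of \<open>vs\<close>, so the number of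
    rungs plus the length of \<open>vs\<close> stays the same. On rung 0 the first p steps already
    land in \<open>J\<close>, and the others do not leave it.\<close>
  have chain: "k + length vs \<ge> p \<Longrightarrow> foldl (twisted_step x) f vs \<in> J" for vs
    using assms(2)
  proof (induction arbitrary: vs rule: ladder.induct)
    case (ladder_0 f)
    have "foldl (twisted_step x) f (take p vs) \<in> J"
      using foldl_twisted_step_mem[OF assms(1), of p "[]" "take p vs" x f] ladder_0 by simp
    moreover have "foldl (twisted_step x) g ws \<in> J" if "g \<in> J" for g ws
      using that
      by (induction ws arbitrary: g)
        (simp_all add: twisted_step_def commutator_def diff_mem lmult_mem rmult_mem)
    ultimately have "foldl (twisted_step x) f (take p vs @ drop p vs) \<in> J"
      unfolding foldl_append by blast
    then show ?case by simp
  next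
    case (ladder_step k f r)
    then show ?case using ladder_step.IH[of "r # vs"] by (simp add: twisted_step_def)
  next
    case (ladder_add k f g)
    then show ?case by (simp add: foldl_twisted_step_add add_mem)
  qed
  show ?thesis using chain[of "[]"] assms(3) by simp
qed

end

section \<open>The free algebra\<close>

lemma const_add: "const (c + d) = const c + const d"
  and const_mult: "const (c * d) = const c * const d"
  and const_0 [simp]: "const 0 = 0"
  and const_1 [simp]: "const 1 = 1"
  and const_uminus: "const (- c) = - const c"
  and const_diff: "const (c - d) = const c - const d"
  by (simp_all add: const_def single_add mult_single single_uminus single_diff)

lemma const_of_nat: "const (of_nat k) = of_nat k"
  by (induction k) (simp_all add: const_add)

lemma const_numeral: "const (numeral k) = numeral k"
  using const_of_nat[of "numeral k"] by simp

lemma const_sum: "const (sum f S) = (\<Sum>i\<in>S. const (f i))"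
  by (induction S rule: infinite_finite_induct) (simp_all add: const_add)

lemma poly_mapping_eq_sum_single:
  "f = (\<Sum>w\<in>Poly_Mapping.keys f. Poly_Mapping.single w (Poly_Mapping.lookup f w))"
proof (rule poly_mapping_eqI)
  fix v
  have "Poly_Mapping.lookup f v
      = (\<Sum>w\<in>Poly_Mapping.keys f. if w = v then Poly_Mapping.lookup f w else 0)"
    by (auto simp: in_keys_iff)
  then show "Poly_Mapping.lookup f v
      = Poly_Mapping.lookup (\<Sum>w\<in>Poly_Mapping.keys f. Poly_Mapping.single w (Poly_Mapping.lookup f w)) v"
    by (simp add: lookup_sum lookup_single when_def)
qed

lemma poly_mapping_induct_single [case_names single add]:
  fixes P :: "('a \<Rightarrow>\<^sub>0 'b::comm_monoid_add) \<Rightarrow> bool"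
  assumes single: "\<And>w c. P (Poly_Mapping.single w c)"
    and add: "\<And>f g. P f \<Longrightarrow> P g \<Longrightarrow> P (f + g)"
  shows "P f"
proof -
  have "P 0" using single[of _ 0] by simp
  then have "P (\<Sum>w\<in>S. Poly_Mapping.single w (h w))" for S h
    by (induction S rule: infinite_finite_induct) (simp_all add: assms)
  then show ?thesis by (subst poly_mapping_eq_sum_single)
qed

lemma const_left_commute: "f * (const c * g) = const c * (f * g)"
proof -
  have "f * const c = const c * f" for f :: "'n free_algebra"
    by (induction f rule: poly_mapping_induct_single)
      (simp_all add: const_def mult_single distrib_left distrib_right mult.commute)
  then show ?thesis by (metis mult.assoc)
qed

lemma const_commute: "f * const c = const c * f"
  using const_left_commute[of f c 1] by simp

definition monomial :: "'n list \<Rightarrow> 'n free_algebra"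
  where "monomial ls = Poly_Mapping.single (Word ls) 1"

lemma monomial_Nil [simp]: "monomial [] = 1"
  by (simp add: monomial_def flip: zero_word_def)

lemma monomial_append: "monomial (ls @ ls') = monomial ls * monomial ls'"
  by (simp add: monomial_def mult_single plus_word_def)

lemma monomial_Cons: "monomial (l # ls) = gen l * monomial ls"
  by (simp add: monomial_def gen_def mult_single plus_word_def)

lemma monomial_singleton: "monomial [l] = gen l"
  by (simp add: monomial_def gen_def)

lemma single_eq_const_mult_monomial: "Poly_Mapping.single w c = const c * monomial (letters w)"
  by (simp add: monomial_def const_def mult_single)

lemma free_algebra_eq_sum:
  "f = (\<Sum>w\<in>Poly_Mapping.keys f. const (Poly_Mapping.lookup f w) * monomial (letters w))"
  using poly_mapping_eq_sum_single[of f] by (simp add: single_eq_const_mult_monomial)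

lemma free_algebra_induct [case_names const gen add]:
  assumes "\<And>c. P (const c)" and "\<And>l f. P f \<Longrightarrow> P (gen l * f)"
    and "\<And>f g. P f \<Longrightarrow> P g \<Longrightarrow> P (f + g)"
  shows "P f"
proof (induction f rule: poly_mapping_induct_single)
  case (single w c)
  have "P (monomial ls * const c)" for ls
    by (induction ls) (simp_all add: assms monomial_Cons mult.assoc)
  then show ?case by (simp add: single_eq_const_mult_monomial const_commute)
qed (simp add: assms)

section \<open>Linear maps given by their values on words\<close>

definition lin_ext :: "('n list \<Rightarrow> 'n free_algebra) \<Rightarrow> 'n free_algebra \<Rightarrow> 'n free_algebra"
  where "lin_ext \<phi> f =
    (\<Sum>w\<in>Poly_Mapping.keys f. const (Poly_Mapping.lookup f w) * \<phi> (letters w))"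

lemma lin_ext_superset:
  assumes "finite S" "Poly_Mapping.keys f \<subseteq> S"
  shows "lin_ext \<phi> f = (\<Sum>w\<in>S. const (Poly_Mapping.lookup f w) * \<phi> (letters w))"
  unfolding lin_ext_def using assms by (intro sum.mono_neutral_left) (auto simp: in_keys_iff)

lemma lin_ext_add: "lin_ext \<phi> (f + g) = lin_ext \<phi> f + lin_ext \<phi> g"
proof -
  let ?S = "Poly_Mapping.keys f \<union> Poly_Mapping.keys g"
  have "lin_ext \<phi> h = (\<Sum>w\<in>?S. const (Poly_Mapping.lookup h w) * \<phi> (letters w))"
    if "Poly_Mapping.keys h \<subseteq> ?S" for h
    using that by (intro lin_ext_superset) simp_all
  from this[of f] this[of g] this[of "f + g"] show ?thesis
    by (simp add: keys_add lookup_add const_add distrib_right sum.distrib)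
qed

lemma lin_ext_const_mult_monomial: "lin_ext \<phi> (const c * monomial ls) = const c * \<phi> ls"
  by (simp add: lin_ext_def const_def monomial_def mult_single)

lemma lin_ext_const_mult: "lin_ext \<phi> (const c * f) = const c * lin_ext \<phi> f"
proof (induction f rule: poly_mapping_induct_single)
  case (single w d)
  have "const c * Poly_Mapping.single w d = const (c * d) * monomial (letters w)"
    by (simp add: single_eq_const_mult_monomial const_mult mult.assoc)
  then show ?case
    by (simp only: single_eq_const_mult_monomial[of w d] lin_ext_const_mult_monomial)
      (simp add: const_mult mult.assoc)
qed (simp add: lin_ext_add distrib_left)

lemma lin_ext_monomial: "lin_ext \<phi> (monomial ls) = \<phi> ls"
  using lin_ext_const_mult_monomial[of \<phi> 1 ls] by simp

lemma lin_ext_const: "lin_ext \<phi> (const c) = const c * \<phi> []"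
  using lin_ext_const_mult_monomial[of \<phi> c "[]"] by simp

text \<open>Lifts a recursion on the first letter of a word to the linear extension: \<alpha> is the
  term produced by that letter, \<beta> the factor it leaves behind. Both the derivatives and the
  substitutions arise in this way.\<close>

lemma lin_ext_gen_mult:
  assumes "\<And>ls. \<phi> (l # ls) = \<alpha> (monomial ls) + \<beta> * \<phi> ls"
    and "\<And>f g. \<alpha> (f + g) = \<alpha> f + \<alpha> g" and "\<And>c f. \<alpha> (const c * f) = const c * \<alpha> f"
  shows "lin_ext \<phi> (gen l * f) = \<alpha> f + \<beta> * lin_ext \<phi> f"
proof (induction f rule: poly_mapping_induct_single)
  case (single w c)
  have "gen l * (const c * monomial (letters w)) = const c * monomial (l # letters w)"
    by (simp add: const_left_commute[of "gen l"] monomial_Cons)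
  then show ?case
    by (simp add: single_eq_const_mult_monomial lin_ext_const_mult_monomial assms distrib_left
        const_left_commute[of \<beta>])
qed (simp add: lin_ext_add distrib_left assms)

section \<open>Partial derivatives as commuting derivations\<close>

fun pd_word :: "'n \<Rightarrow> 'n list \<Rightarrow> 'n free_algebra"
  where
    "pd_word j [] = 0"
  | "pd_word j (l # ls) = (if l = j then monomial ls else 0) + gen l * pd_word j ls"

definition pd :: "'n \<Rightarrow> 'n free_algebra \<Rightarrow> 'n free_algebra"
  where "pd j = lin_ext (pd_word j)"

lemma pd_add: "pd j (f + g) = pd j f + pd j g"
  and pd_const_mult: "pd j (const c * f) = const c * pd j f"
  and pd_const [simp]: "pd j (const c) = 0"
  by (simp_all add: pd_def lin_ext_add lin_ext_const_mult lin_ext_const)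

lemma pd_gen_mult: "pd j (gen l * f) = (if l = j then f else 0) + gen l * pd j f"
  unfolding pd_def
  by (rule lin_ext_gen_mult[where \<alpha> = "\<lambda>f. if l = j then f else 0"]) auto

lemma pd_0 [simp]: "pd j 0 = 0" and pd_1 [simp]: "pd j 1 = 0"
  using pd_const[of j 0] pd_const[of j 1] by simp_all

lemma pd_gen: "pd j (gen l) = (if l = j then 1 else 0)"
  using pd_gen_mult[of j l 1] by simp

lemma pd_uminus: "pd j (- f) = - pd j f"
  using pd_const_mult[of j "-1" f] by (simp add: const_uminus)

lemma pd_diff: "pd j (f - g) = pd j f - pd j g"
  using pd_add[of j f "- g"] by (simp add: pd_uminus)

lemma pd_sum: "pd j (sum f S) = (\<Sum>i\<in>S. pd j (f i))"
  by (induction S rule: infinite_finite_induct) (simp_all add: pd_add)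

lemma pd_mult: "pd j (f * g) = pd j f * g + f * pd j g"
  by (induction f rule: free_algebra_induct)
    (simp_all add: pd_add pd_const_mult pd_gen_mult mult.assoc distrib_left distrib_right add_ac)

lemma pd_commute: "pd j (pd l f) = pd l (pd j f)"
  by (induction f rule: free_algebra_induct) (simp_all add: pd_add pd_gen_mult algebra_simps)

section \<open>Linear substitutions\<close>

lemma act_eq_lin_ext: "act A = lin_ext (\<lambda>ls. prod_list (map (\<lambda>j. embed (A *v axis j 1)) ls))"
  by (rule ext) (simp add: act_def lin_ext_def)

lemma act_add: "act A (f + g) = act A f + act A g"
  and act_const_mult: "act A (const c * f) = const c * act A f"
  and act_const [simp]: "act A (const c) = const c"
  by (simp_all add: act_eq_lin_ext lin_ext_add lin_ext_const_mult lin_ext_const)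

lemma act_gen_mult: "act A (gen l * f) = embed (A *v axis l 1) * act A f"
  using lin_ext_gen_mult[of "\<lambda>ls. prod_list (map (\<lambda>j. embed (A *v axis j 1)) ls)" l "\<lambda>_. 0"]
  by (simp add: act_eq_lin_ext)

lemma act_0 [simp]: "act A 0 = 0" and act_1 [simp]: "act A 1 = 1"
  using act_const[of A 0] act_const[of A 1] by simp_all

lemma act_gen: "act A (gen l) = embed (A *v axis l 1)"
  using act_gen_mult[of A l 1] by simp

lemma act_uminus: "act A (- f) = - act A f"
  using act_const_mult[of A "-1" f] by (simp add: const_uminus)

lemma act_diff: "act A (f - g) = act A f - act A g"
  using act_add[of A f "- g"] by (simp add: act_uminus)

lemma act_sum: "act A (sum f S) = (\<Sum>i\<in>S. act A (f i))"
  by (induction S rule: infinite_finite_induct) (simp_all add: act_add)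

lemma act_mult: "act A (f * g) = act A f * act A g"
  by (induction f rule: free_algebra_induct)
    (simp_all add: act_add act_const_mult act_gen_mult mult.assoc distrib_right)

lemma matrix_vector_mult_axis: "(A *v axis l 1) $ m = A $ m $ l"
  by (simp add: matrix_vector_mult_def axis_def if_distrib[of "\<lambda>c. _ * c"] cong: if_cong)

lemma act_gen_eq_sum: "act A (gen l) = (\<Sum>m\<in>UNIV. const (A $ m $ l) * gen m)"
  by (simp add: act_gen embed_def matrix_vector_mult_axis)

lemma act_act: "act A (act B f) = act (A ** B) f"
proof (induction f rule: free_algebra_induct)
  case (gen l f)
  have "act A (act B (gen l)) = (\<Sum>m\<in>UNIV. const (B $ m $ l) * (\<Sum>k\<in>UNIV. const (A $ k $ m) * gen k))"
    by (simp add: act_gen_eq_sum act_sum act_const_mult)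
  also have "\<dots> = (\<Sum>k\<in>UNIV. \<Sum>m\<in>UNIV. const (A $ k $ m * B $ m $ l) * gen k)"
    by (subst sum.swap)
      (simp add: sum_distrib_left const_mult mult.assoc
        mult.commute[of "A $ _ $ _" "B $ _ $ _"])
  also have "\<dots> = act (A ** B) (gen l)"
    by (simp add: act_gen_eq_sum matrix_matrix_mult_def const_sum sum_distrib_right)
  finally show ?case using gen by (simp add: act_mult)
qed (simp_all add: act_add)

lemma act_mat_1: "act (mat 1) f = f"
proof (induction f rule: free_algebra_induct)
  case (gen l f)
  have "act (mat 1) (gen l) = gen l"
    by (simp add: act_gen_eq_sum mat_def if_distrib[of const] if_distrib[of "\<lambda>c. c * gen _"] cong: if_cong)
  then show ?case using gen by (simp add: act_mult)
qed (simp_all add: act_add)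

text \<open>The chain rule for a linear substitution: \<open>x_j\<close> occurs in the image of
  \<open>x_l\<close> with coefficient \<open>A $ j $ l\<close>.\<close>

lemma pd_act: "pd j (act A f) = (\<Sum>m\<in>UNIV. const (A $ j $ m) * act A (pd m f))"
proof (induction f rule: free_algebra_induct)
  case (gen l f)
  have 1: "pd j (act A (gen l)) = const (A $ j $ l)"
    by (simp add: act_gen_eq_sum pd_sum pd_const_mult pd_gen if_distrib[of "\<lambda>c. _ * c"] cong: if_cong)
  have "pd j (act A (gen l * f)) = const (A $ j $ l) * act A f
      + act A (gen l) * (\<Sum>m\<in>UNIV. const (A $ j $ m) * act A (pd m f))"
    by (simp add: act_mult pd_mult 1 gen)
  also have "const (A $ j $ l) * act A f = (\<Sum>m\<in>UNIV. const (A $ j $ m) * act A (if l = m then f else 0))"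
    by (simp add: if_distrib[of "act A"] if_distrib[of "\<lambda>c. _ * c"] cong: if_cong)
  finally show ?case
    by (simp add: pd_gen_mult act_add act_mult distrib_left sum.distrib sum_distrib_left
        const_left_commute[of "act A (gen l)"])
qed (simp_all add: pd_add act_add distrib_left sum.distrib)

text \<open>One predicate serves for total degree, degree in one variable and multidegree, so that
  the closure properties are proved once.\<close>

definition supported :: "('n list \<Rightarrow> bool) \<Rightarrow> 'n free_algebra \<Rightarrow> bool"
  where "supported Q f \<longleftrightarrow> (\<forall>w\<in>Poly_Mapping.keys f. Q (letters w))"

lemma homogeneous_eq_supported: "homogeneous i = supported (\<lambda>ls. length ls = i)"
  by (rule ext) (simp add: homogeneous_def supported_def)

lemma supported_0 [simp]: "supported Q 0"
  by (simp add: supported_def)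

lemma supported_const_mult_monomial: "Q ls \<Longrightarrow> supported Q (const c * monomial ls)"
  by (simp add: supported_def const_def monomial_def mult_single)

lemma supported_monomial: "Q ls \<Longrightarrow> supported Q (monomial ls)"
  using supported_const_mult_monomial[of Q ls 1] by simp

lemma supported_add: "supported Q f \<Longrightarrow> supported Q g \<Longrightarrow> supported Q (f + g)"
  using keys_add[of f g] unfolding supported_def by blast

lemma supported_sum: "(\<And>i. i \<in> S \<Longrightarrow> supported Q (f i)) \<Longrightarrow> supported Q (sum f S)"
  by (induction S rule: infinite_finite_induct) (simp_all add: supported_add)

lemma supported_induct [consumes 1, case_names zero monomial add]:
  assumes "supported Q f" and "P 0" and "\<And>c ls. Q ls \<Longrightarrow> P (const c * monomial ls)"
    and "\<And>f g. P f \<Longrightarrow> P g \<Longrightarrow> P (f + g)"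
  shows "P f"
proof -
  have "P (\<Sum>w\<in>S. const (h w) * monomial (letters w))" if "\<forall>w\<in>S. Q (letters w)" for S h
    using that by (induction S rule: infinite_finite_induct) (simp_all add: assms)
  then show ?thesis
    using assms(1) by (subst free_algebra_eq_sum) (simp add: supported_def)
qed

lemma supported_mult:
  assumes "supported Q f" "supported Q' g" "\<And>ls ls'. Q ls \<Longrightarrow> Q' ls' \<Longrightarrow> Q'' (ls @ ls')"
  shows "supported Q'' (f * g)"
  using assms(1)
proof (induction rule: supported_induct)
  case (monomial c ls)
  show ?case using assms(2)
  proof (induction rule: supported_induct)
    case (monomial d ls')
    have "const c * monomial ls * (const d * monomial ls') = const (c * d) * monomial (ls @ ls')"
      by (simp add: const_left_commute[of "monomial ls"] const_mult monomial_append mult.assoc)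
    then show ?case
      using assms(3) \<open>Q ls\<close> monomial by (simp add: supported_const_mult_monomial)
  qed (simp_all add: distrib_left supported_add)
qed (simp_all add: distrib_right supported_add)

lemma supported_const_mult:
  assumes "supported Q f"
  shows "supported Q (const c * f)"
proof (rule supported_mult[OF _ assms])
  show "supported (\<lambda>ls. ls = []) (const c)"
    using supported_const_mult_monomial[of "\<lambda>ls. ls = []" "[]" c] by simp
qed simp

lemma supported_uminus: "supported Q f \<Longrightarrow> supported Q (- f)"
  using supported_const_mult[of Q f "-1"] by (simp add: const_uminus)

lemma supported_diff: "supported Q f \<Longrightarrow> supported Q g \<Longrightarrow> supported Q (f - g)"
  using supported_add[OF _ supported_uminus, of Q f g] by simp

lemma supported_pd:
  assumes "supported Q f" "\<And>ls ls'. Q (ls @ j # ls') \<Longrightarrow> Q' (ls @ ls')"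
  shows "supported Q' (pd j f)"
  using assms(1)
proof (induction rule: supported_induct)
  case (monomial c ls)
  \<comment> \<open>The prefix \<open>ks\<close> keeps the letters already passed, so that
    \<open>Q\<close> always speaks about the whole word.\<close>
  have "supported Q' (monomial ks * pd j (monomial ls))" if "Q (ks @ ls)" for ks
    using that
  proof (induction ls arbitrary: ks)
    case (Cons l ls)
    have "monomial ks * pd j (monomial (l # ls))
        = (if l = j then monomial (ks @ ls) else 0) + monomial (ks @ [l]) * pd j (monomial ls)"
      by (simp add: monomial_Cons pd_gen_mult distrib_left monomial_append mult.assoc)
    then show ?case
      using Cons assms(2) by (auto intro!: supported_add supported_monomial)
  qed simp
  from this[of "[]"] show ?case using monomial by (simp add: pd_const_mult supported_const_mult)
qed (simp_all add: pd_add supported_add)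

lemma homogeneous_pd: "homogeneous (Suc i) f \<Longrightarrow> homogeneous i (pd j f)"
  unfolding homogeneous_eq_supported by (rule supported_pd[of "\<lambda>ls. length ls = Suc i"]) auto

lemma homogeneous_0_pd: "homogeneous 0 f \<Longrightarrow> pd j f = 0"
  unfolding homogeneous_eq_supported
  by (induction rule: supported_induct) (simp_all add: pd_add pd_const_mult)

lemma homogeneous_gen_mult:
  assumes "homogeneous i f"
  shows "homogeneous (Suc i) (gen j * f)"
proof -
  have "supported (\<lambda>ls. ls = [j]) (gen j)"
    using supported_monomial[of "\<lambda>ls. ls = [j]" "[j]"] by (simp add: monomial_singleton)
  from supported_mult[OF this assms[unfolded homogeneous_eq_supported], of "\<lambda>ls. length ls = Suc i"]
  show ?thesis by (simp add: homogeneous_eq_supported)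
qed

lemma homogeneous_act:
  assumes "homogeneous i f"
  shows "homogeneous i (act A f)"
  using assms unfolding homogeneous_eq_supported
proof (induction rule: supported_induct)
  case (monomial c ls)
  have "homogeneous (length ls) (act A (monomial ls))"
  proof (induction ls)
    case Nil
    then show ?case
      using supported_monomial[of "\<lambda>ls. length ls = 0" "[]"] by (simp add: homogeneous_eq_supported)
  next
    case (Cons l ls)
    then show ?case
      unfolding monomial_Cons act_mult act_gen_eq_sum sum_distrib_right mult.assoc length_Cons
        homogeneous_eq_supported
      by (intro supported_sum supported_const_mult)
        (use homogeneous_gen_mult in \<open>auto simp: homogeneous_eq_supported\<close>)
  qed
  then show ?case
    using monomial by (simp add: act_const_mult homogeneous_eq_supported supported_const_mult)
qed (simp_all add: act_add supported_add)

section \<open>The ideals\<close>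

lemma ring_free_ring: "ring (free_ring :: 'n free_algebra ring)"
proof (rule ringI)
  show "abelian_group (free_ring :: 'n free_algebra ring)"
  proof (rule abelian_groupI)
    fix f :: "'n free_algebra"
    show "\<exists>g\<in>carrier free_ring. g \<oplus>\<^bsub>free_ring\<^esub> f = \<zero>\<^bsub>free_ring\<^esub>"
      by (rule bexI[of _ "- f"]) (simp_all add: free_ring_def)
  qed (simp_all add: free_ring_def algebra_simps)
  show "Group.monoid (free_ring :: 'n free_algebra ring)"
    by (rule monoidI) (simp_all add: free_ring_def mult.assoc)
qed (simp_all add: free_ring_def algebra_simps)

lemma ring_ideal_lie_ideal: "ring_ideal (lie_ideal m :: 'n free_algebra set)"
proof -
  interpret R: ring "free_ring :: 'n free_algebra ring" by (rule ring_free_ring)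
  interpret I: ideal "lie_ideal m" "free_ring :: 'n free_algebra ring"
    unfolding lie_ideal_def by (rule R.genideal_ideal) (simp add: free_ring_def)
  show ?thesis
    using I.a_closed I.zero_closed I.I_l_closed I.I_r_closed
    by unfold_locales (simp_all add: free_ring_def)
qed

lemma left_normed_mem_lie_ideal: "length us = m \<Longrightarrow> left_normed us \<in> lie_ideal m"
  using ring.genideal_self[OF ring_free_ring, of "{left_normed us |us. length us = m}"]
  by (auto simp: lie_ideal_def free_ring_def)

lemma lie_ideal_minimal:
  assumes "ring_ideal J" and "\<And>us. length us = m \<Longrightarrow> left_normed us \<in> J"
  shows "lie_ideal m \<subseteq> (J :: 'n free_algebra set)"
proof -
  interpret J: ring_ideal J by fact
  interpret R: ring "free_ring :: 'n free_algebra ring" by (rule ring_free_ring)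
  have "ideal J (free_ring :: 'n free_algebra ring)"
  proof (rule idealI)
    show "subgroup J (add_monoid (free_ring :: 'n free_algebra ring))"
    proof (rule R.add.subgroupI)
      fix f assume f: "f \<in> J"
      have "\<ominus>\<^bsub>free_ring\<^esub> f = - f"
        by (rule R.minus_equality) (simp_all add: free_ring_def)
      then show "\<ominus>\<^bsub>free_ring\<^esub> f \<in> J"
        using J.uminus_mem[OF f] by simp
    qed (use J.zero_mem J.add_mem in \<open>auto simp: free_ring_def\<close>)
  qed (use J.lmult_mem J.rmult_mem in \<open>auto simp: free_ring_def ring_free_ring[unfolded free_ring_def]\<close>)
  then show ?thesis
    unfolding lie_ideal_def by (rule R.genideal_minimal) (use assms(2) in auto)
qed

text \<open>By the Leibniz rule each term is again a left-normed commutator of the same length. The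
  induction needs \<open>J\<close> to be merely an additively closed set that may change: for
  \<open>us @ [u]\<close> the hypothesis is applied to the set of all \<open>f\<close> with
  \<open>[f, u]\<close> in \<open>J\<close>.\<close>

lemma pd_left_normed_mem:
  assumes "us \<noteq> []" and "\<And>vs. length vs = length us \<Longrightarrow> left_normed vs \<in> J"
    and "\<And>f g. f \<in> J \<Longrightarrow> g \<in> J \<Longrightarrow> f + g \<in> J"
  shows "pd j (left_normed us) \<in> J"
  using assms
proof (induction us arbitrary: J rule: rev_nonempty_induct)
  case (single u)
  then show ?case using single.prems(1)[of "[pd j u]"] by (simp add: left_normed_def)
next
  case (snoc u us)
  have "left_normed (vs @ [v]) \<in> J \<and> vs \<noteq> []" if "length vs = length us" for vs v
    using snoc.prems(1)[of "vs @ [v]"] snoc.hyps that by auto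
  then have mem: "commutator (left_normed vs) v \<in> J" if "length vs = length us" for vs v
    using that by (metis left_normed_snoc)
  have "pd j (left_normed us) \<in> {f. commutator f u \<in> J}"
    by (rule snoc.IH) (auto simp: mem commutator_add_left snoc.prems(2))
  moreover have "commutator (left_normed us) (pd j u) \<in> J"
    by (rule mem) simp
  moreover have "pd j (left_normed (us @ [u]))
      = commutator (pd j (left_normed us)) u + commutator (left_normed us) (pd j u)"
    using snoc.hyps by (simp add: left_normed_snoc) (simp add: commutator_def pd_diff pd_mult)
  ultimately show ?case using snoc.prems(2) by simp
qed

lemma act_left_normed: "us \<noteq> [] \<Longrightarrow> act A (left_normed us) = left_normed (map (act A) us)"
  by (induction us rule: rev_nonempty_induct)
    (simp add: left_normed_def, simp add: left_normed_snoc commutator_def act_diff act_mult)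

locale invariant_ideal = ring_ideal J for J :: "'n::finite free_algebra set" +
  assumes pd_mem: "f \<in> J \<Longrightarrow> pd j f \<in> J"
    and act_mem: "f \<in> J \<Longrightarrow> act A f \<in> J"

text \<open>By minimality it suffices that the elements with the wanted property form an ideal
  containing the generators. For the derivatives, membership of \<open>f\<close> itself is part of
  the property, since the Leibniz rule leaves one factor undifferentiated.\<close>

lemma invariant_ideal_lie_ideal:
  assumes "m > 0"
  shows "invariant_ideal (lie_ideal m :: 'n::finite free_algebra set)"
proof -
  let ?I = "lie_ideal m :: 'n free_algebra set"
  interpret I: ring_ideal ?I by (rule ring_ideal_lie_ideal)
  have "?I \<subseteq> {f \<in> ?I. pd j f \<in> ?I}" for j
  proof (rule lie_ideal_minimal)
    show "ring_ideal {f \<in> ?I. pd j f \<in> ?I}"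
      by unfold_locales
        (auto simp: pd_add pd_mult intro: I.zero_mem I.add_mem I.lmult_mem I.rmult_mem)
    fix us :: "'n free_algebra list" assume us: "length us = m"
    have "pd j (left_normed us) \<in> ?I"
      by (rule pd_left_normed_mem) (use us assms I.add_mem left_normed_mem_lie_ideal in auto)
    then show "left_normed us \<in> {f \<in> ?I. pd j f \<in> ?I}"
      using us left_normed_mem_lie_ideal by auto
  qed
  moreover have "?I \<subseteq> {f. act A f \<in> ?I}" for A
  proof (rule lie_ideal_minimal)
    show "ring_ideal {f. act A f \<in> ?I}"
      by unfold_locales
        (auto simp: act_add act_mult intro: I.zero_mem I.add_mem I.lmult_mem I.rmult_mem)
    fix us :: "'n free_algebra list" assume us: "length us = m"
    then have "us \<noteq> []" using assms by auto
    then show "left_normed us \<in> {f. act A f \<in> ?I}"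
      using us left_normed_mem_lie_ideal[of "map (act A) us"] by (simp add: act_left_normed)
  qed
  ultimately show ?thesis by unfold_locales auto
qed

section \<open>The Laplacian\<close>

definition lap :: "'n::finite free_algebra \<Rightarrow> 'n free_algebra"
  where "lap f = (\<Sum>j\<in>UNIV. pd j (pd j f))"

text \<open>On noncommutative words this is not multiplication by the degree, because the
  differentiated letter is moved to the front. It is a degree operator only up to the filtration,
  see \<open>filt_euler\<close>.\<close>

definition euler :: "'n::finite free_algebra \<Rightarrow> 'n free_algebra"
  where "euler f = (\<Sum>j\<in>UNIV. gen j * pd j f)"

definition rsq :: "'n::finite free_algebra"
  where "rsq = (\<Sum>j\<in>UNIV. gen j * gen j)"

lemma lap_add: "lap (f + g) = lap f + lap g"
  and lap_diff: "lap (f - g) = lap f - lap g"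
  and lap_const_mult: "lap (const c * f) = const c * lap f"
  by (simp_all add: lap_def pd_add pd_diff pd_const_mult sum.distrib sum_subtractf sum_distrib_left)

lemma euler_add: "euler (f + g) = euler f + euler g"
  by (simp add: euler_def pd_add sum.distrib distrib_left)

lemma pd_lap: "pd j (lap f) = lap (pd j f)"
  by (simp add: lap_def pd_sum pd_commute[of j])

lemma pd_rsq_mult: "pd j (rsq * f) = 2 * (gen j * f) + rsq * pd j f"
proof -
  have "pd j rsq = (\<Sum>l\<in>UNIV. if l = j then 2 * gen j else 0)"
    unfolding rsq_def pd_sum by (rule sum.cong) (auto simp: pd_gen_mult pd_gen mult_2)
  then show ?thesis by (simp add: pd_mult mult.assoc)
qed

text \<open>The classical relation is exact already in the free algebra: the derivative of
  \<open>rsq\<close> is \<open>2 * gen j\<close> without commuting any variables, and all new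
  factors stand on the left, as in \<open>euler\<close>.\<close>

lemma lap_rsq_mult:
  fixes f :: "'n::finite free_algebra"
  shows "lap (rsq * f) = rsq * lap f + 4 * euler f + of_nat (2 * CARD('n)) * f"
proof -
  have "pd j (pd j (rsq * f)) = 2 * f + 4 * (gen j * pd j f) + rsq * pd j (pd j f)" for j
  proof -
    have "pd j (2 * g) = 2 * pd j g" for g :: "'n free_algebra"
      using pd_const_mult[of j 2 g] by (simp add: const_numeral)
    moreover have "4 * g = 2 * g + 2 * g" for g :: "'n free_algebra"
      by (simp flip: distrib_right)
    ultimately show ?thesis
      by (simp add: pd_rsq_mult pd_add pd_gen_mult distrib_left add_ac)
  qed
  then show ?thesis
    by (simp add: lap_def euler_def sum.distrib sum_distrib_left mult.assoc mult_2[of f]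
        mult_2[of "of_nat _ * f"] distrib_left)
qed

lemma homogeneous_const_mult: "homogeneous i f \<Longrightarrow> homogeneous i (const c * f)"
  and homogeneous_add: "homogeneous i f \<Longrightarrow> homogeneous i g \<Longrightarrow> homogeneous i (f + g)"
  and homogeneous_diff: "homogeneous i f \<Longrightarrow> homogeneous i g \<Longrightarrow> homogeneous i (f - g)"
  and homogeneous_zero [simp]: "homogeneous i 0"
  by (simp_all add: homogeneous_eq_supported supported_const_mult supported_add supported_diff)

lemma homogeneous_sum: "(\<And>j. j \<in> S \<Longrightarrow> homogeneous i (f j)) \<Longrightarrow> homogeneous i (sum f S)"
  by (simp add: homogeneous_eq_supported supported_sum)

lemma homogeneous_lap: "homogeneous (Suc (Suc i)) f \<Longrightarrow> homogeneous i (lap f)"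
  unfolding lap_def by (intro homogeneous_sum homogeneous_pd)

lemma homogeneous_euler: "homogeneous i f \<Longrightarrow> homogeneous i (euler f)"
  unfolding euler_def
  by (cases i) (auto simp: homogeneous_0_pd intro!: homogeneous_sum homogeneous_gen_mult homogeneous_pd)

lemma homogeneous_rsq_mult: "homogeneous i f \<Longrightarrow> homogeneous (Suc (Suc i)) (rsq * f)"
  unfolding rsq_def sum_distrib_right mult.assoc by (intro homogeneous_sum homogeneous_gen_mult)

lemma lap_eq_0:
  assumes "homogeneous i f" "i < 2"
  shows "lap f = 0"
proof -
  from assms(2) consider "i = 0" | "i = Suc 0" by linarith
  then have "pd j (pd j f) = 0" for j
    by cases (use assms(1) homogeneous_0_pd homogeneous_pd in fastforce)+
  then show ?thesis by (simp add: lap_def)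
qed

lemma euler_act: "euler (act A f) = act A (euler f)"
proof -
  have "act A (euler f) = (\<Sum>j\<in>UNIV. \<Sum>m\<in>UNIV. const (A $ m $ j) * gen m * act A (pd j f))"
    by (simp add: euler_def act_sum act_mult act_gen_eq_sum sum_distrib_right)
  also have "\<dots> = (\<Sum>m\<in>UNIV. \<Sum>j\<in>UNIV. const (A $ m $ j) * gen m * act A (pd j f))"
    by (rule sum.swap)
  also have "\<dots> = euler (act A f)"
    by (simp add: euler_def pd_act sum_distrib_left const_left_commute[of "gen _"] mult.assoc)
  finally show ?thesis ..
qed

section \<open>Equivariance under orthogonal matrices\<close>

lemma SO_transpose_mult:
  assumes "A \<in> SO"
  shows "transpose A ** A = mat 1"
proof (simp add: vec_eq_iff, intro allI)
  fix j k
  have "bilin (A *v axis j 1) (A *v axis k 1) = bilin (axis j 1) (axis k 1)"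
    using assms by (simp add: SO_def)
  then show "(transpose A ** A) $ j $ k = mat 1 $ j $ k"
    unfolding bilin_def matrix_vector_mult_axis
    by (auto simp: matrix_matrix_mult_def transpose_def mat_def axis_def if_distrib[of "\<lambda>c. _ * c"] cong: if_cong)
qed

lemma SO_transpose:
  assumes "A \<in> SO"
  shows "transpose A \<in> SO"
proof -
  have "bilin (transpose A *v u) (transpose A *v v) = bilin u v" for u v
  proof -
    have "bilin (transpose A *v u) (transpose A *v v)
        = bilin (A *v (transpose A *v u)) (A *v (transpose A *v v))"
      using assms by (simp add: SO_def)
    also have "\<dots> = bilin u v"
      using SO_transpose_mult[OF assms] matrix_left_right_inverse[of "transpose A" A]
      by (simp only: matrix_vector_mul_assoc matrix_vector_mul_lid)
    finally show ?thesis .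
  qed
  then show ?thesis using assms by (simp add: SO_def)
qed

lemma SO_sum_columns:
  assumes "A \<in> SO"
  shows "(\<Sum>m\<in>UNIV. A $ m $ j * A $ m $ k) = (if j = k then 1 else 0)"
  using SO_transpose_mult[OF assms]
  by (auto simp: vec_eq_iff matrix_matrix_mult_def transpose_def mat_def)

lemma SO_sum_rows: "A \<in> SO \<Longrightarrow> (\<Sum>m\<in>UNIV. A $ j $ m * A $ k $ m) = (if j = k then 1 else 0)"
  using SO_sum_columns[OF SO_transpose, of A j k] by (simp add: transpose_def)

lemma lap_act:
  assumes "A \<in> SO"
  shows "lap (act A f) = act A (lap f)"
proof -
  have "lap (act A f) = (\<Sum>j\<in>UNIV. \<Sum>m\<in>UNIV. \<Sum>l\<in>UNIV.
      const (A $ j $ m * A $ j $ l) * act A (pd l (pd m f)))"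
    by (simp add: lap_def pd_act pd_sum pd_const_mult sum_distrib_left const_mult mult.assoc)
  also have "\<dots> = (\<Sum>m\<in>UNIV. \<Sum>l\<in>UNIV. \<Sum>j\<in>UNIV.
      const (A $ j $ m * A $ j $ l) * act A (pd l (pd m f)))"
    by (subst sum.swap, rule sum.cong[OF refl], rule sum.swap)
  also have "\<dots> = (\<Sum>m\<in>UNIV. \<Sum>l\<in>UNIV. (if m = l then act A (pd l (pd m f)) else 0))"
    unfolding sum_distrib_right[symmetric] const_sum[symmetric] SO_sum_columns[OF assms]
    by (intro sum.cong) auto
  also have "\<dots> = act A (lap f)" by (simp add: lap_def act_sum)
  finally show ?thesis .
qed

lemma act_rsq:
  assumes "A \<in> SO"
  shows "act A rsq = rsq"
proof -
  have "act A rsq = (\<Sum>j\<in>UNIV. \<Sum>m\<in>UNIV. \<Sum>l\<in>UNIV. const (A $ m $ j * A $ l $ j) * (gen m * gen l))"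
    by (simp add: rsq_def act_sum act_mult act_gen_eq_sum sum_product const_mult mult.assoc
        const_left_commute[of "gen _"])
  also have "\<dots> = (\<Sum>m\<in>UNIV. \<Sum>l\<in>UNIV. \<Sum>j\<in>UNIV. const (A $ m $ j * A $ l $ j) * (gen m * gen l))"
    by (subst sum.swap, rule sum.cong[OF refl], rule sum.swap)
  also have "\<dots> = (\<Sum>m\<in>UNIV. \<Sum>l\<in>UNIV. (if m = l then gen m * gen l else 0))"
    unfolding sum_distrib_right[symmetric] const_sum[symmetric] SO_sum_rows[OF assms]
    by (intro sum.cong) auto
  also have "\<dots> = rsq" by (simp add: rsq_def)
  finally show ?thesis .
qed

section \<open>The filtration by polynomial degree and surjectivity of the Laplacian\<close>

context invariant_ideal
begin

lemma const_mult_cancel: "c \<noteq> 0 \<Longrightarrow> const c * f \<in> J \<Longrightarrow> f \<in> J"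
  using lmult_mem[of "const c * f" "const (1 / c)"] by (simp add: const_mult[symmetric] flip: mult.assoc)

lemma lap_mem: "f \<in> J \<Longrightarrow> lap f \<in> J"
  unfolding lap_def by (intro sum_mem pd_mem)

text \<open>
  The quotient is a polynomial algebra tensored with the image of \<open>filt 1\<close>, and \<open>filt (k + 1)\<close>
  is the part of polynomial degree at most \<open>k\<close>.
\<close>

fun filt :: "nat \<Rightarrow> 'n free_algebra set"
  where
    "filt 0 = J"
  | "filt (Suc k) = {f. \<forall>j. pd j f \<in> filt k}"

lemma filt_add: "f \<in> filt k \<Longrightarrow> g \<in> filt k \<Longrightarrow> f + g \<in> filt k"
  by (induction k arbitrary: f g) (simp_all add: add_mem pd_add)

lemma filt_const_mult: "f \<in> filt k \<Longrightarrow> const c * f \<in> filt k"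
  by (induction k arbitrary: f) (simp_all add: lmult_mem pd_const_mult)

lemma filt_diff: "f \<in> filt k \<Longrightarrow> g \<in> filt k \<Longrightarrow> f - g \<in> filt k"
  using filt_add[OF _ filt_const_mult[of g k "-1"], of f] by (simp add: const_uminus)

lemma filt_zero: "0 \<in> filt k"
  by (induction k) (simp_all add: zero_mem)

lemma filt_sum: "(\<And>i. i \<in> S \<Longrightarrow> f i \<in> filt k) \<Longrightarrow> sum f S \<in> filt k"
  by (induction S rule: infinite_finite_induct) (simp_all add: filt_zero filt_add)

lemma filt_Suc: "f \<in> filt k \<Longrightarrow> f \<in> filt (Suc k)"
  by (induction k arbitrary: f) (auto simp: pd_mem)

lemma filt_ideal: "f \<in> J \<Longrightarrow> f \<in> filt k"
  by (induction k) (auto simp: filt_Suc simp del: filt.simps(2))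

lemma filt_gen_mult: "f \<in> filt k \<Longrightarrow> gen l * f \<in> filt (Suc k)"
proof (induction k arbitrary: f)
  case 0
  then show ?case by (auto simp: pd_gen_mult intro!: add_mem lmult_mem pd_mem)
next
  case (Suc k)
  have "pd j (gen l * f) \<in> filt (Suc k)" for j
    unfolding pd_gen_mult by (rule filt_add) (use Suc filt_zero in auto)
  then show ?case by simp
qed

lemma filt_rsq_mult: "f \<in> filt k \<Longrightarrow> rsq * f \<in> filt (Suc (Suc k))"
  unfolding rsq_def sum_distrib_right mult.assoc by (intro filt_sum filt_gen_mult)

lemma filt_lap: "f \<in> filt k \<Longrightarrow> lap f \<in> filt (k - 2)"
proof -
  assume f: "f \<in> filt k"
  show ?thesis
  proof (cases "k < 2")
    \<comment> \<open>Here the truncated \<open>k - 2\<close> is 0 and the target is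
      \<open>J\<close> itself; the first derivatives of \<open>f\<close> already lie there.\<close>
    case True
    then have "pd j f \<in> J" for j using f by (cases k) (auto simp: pd_mem)
    then show ?thesis using True by (simp add: lap_def sum_mem pd_mem)
  next
    case False
    then obtain m where "k = Suc (Suc m)" by (metis add_2_eq_Suc le_Suc_ex not_less)
    then show ?thesis using f by (auto simp: lap_def intro!: filt_sum)
  qed
qed

lemma filt_act: "f \<in> filt k \<Longrightarrow> act A f \<in> filt k"
  by (induction k arbitrary: f) (auto simp: act_mem pd_act intro!: filt_sum filt_const_mult)

lemma homogeneous_filt: "homogeneous i f \<Longrightarrow> f \<in> filt (Suc i)"
  by (induction i arbitrary: f) (auto simp: homogeneous_0_pd homogeneous_pd zero_mem)

text \<open>The operator \<open>euler\<close> satisfies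
  \<open>pd l (euler f) = pd l f + euler (pd l f)\<close>, so differentiating
  \<open>euler f - k f\<close> gives the same expression for \<open>pd l f\<close> with k lowered by
  one.\<close>

lemma filt_euler: "f \<in> filt (Suc k) \<Longrightarrow> euler f - of_nat k * f \<in> filt k"
proof (induction k arbitrary: f)
  case 0
  then show ?case by (simp add: euler_def sum_mem lmult_mem)
next
  case (Suc k)
  have "pd l (euler f - of_nat (Suc k) * f) = euler (pd l f) - of_nat k * pd l f" for l
  proof -
    have "pd l (euler f) = pd l f + euler (pd l f)"
      by (simp add: euler_def pd_sum pd_gen_mult sum.distrib pd_commute[of l])
    then show ?thesis
      using pd_const_mult[of l "of_nat k" f]
      by (simp add: pd_diff pd_add const_of_nat distrib_right)
  qed
  moreover have "pd l f \<in> filt (Suc k)" for l using Suc.prems by simp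
  ultimately show ?case using Suc.IH by simp
qed

definition inv_mod :: "'n free_algebra \<Rightarrow> bool"
  where "inv_mod f \<longleftrightarrow> (\<forall>A\<in>SO. act A f - f \<in> J)"

lemma inv_mod_add: "inv_mod f \<Longrightarrow> inv_mod g \<Longrightarrow> inv_mod (f + g)"
  unfolding inv_mod_def using add_mem by (fastforce simp: act_add algebra_simps)

lemma inv_mod_mult: "inv_mod f \<Longrightarrow> inv_mod g \<Longrightarrow> inv_mod (f * g)"
proof -
  assume fg: "inv_mod f" "inv_mod g"
  have "act A (f * g) - f * g = (act A f - f) * act A g + f * (act A g - g)" for A
    by (simp add: act_mult algebra_simps)
  then show ?thesis
    using fg unfolding inv_mod_def by (simp add: add_mem lmult_mem rmult_mem)
qed

lemma inv_mod_const: "inv_mod (const c)"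
  by (simp add: inv_mod_def zero_mem)

lemma inv_mod_diff: "inv_mod f \<Longrightarrow> inv_mod g \<Longrightarrow> inv_mod (f - g)"
  using inv_mod_add[OF _ inv_mod_mult[OF inv_mod_const[of "-1"]], of f g] by (simp add: const_uminus)

lemma inv_mod_rsq: "inv_mod rsq"
  by (simp add: inv_mod_def act_rsq zero_mem)

lemma inv_mod_lap: "inv_mod f \<Longrightarrow> inv_mod (lap f)"
  unfolding inv_mod_def by (auto simp: lap_mem simp flip: lap_act lap_diff)

lemma inv_mod_euler: "inv_mod f \<Longrightarrow> inv_mod (euler f)"
proof -
  assume f: "inv_mod f"
  have "euler g \<in> J" if "g \<in> J" for g
    using that by (simp add: euler_def sum_mem lmult_mem pd_mem)
  moreover have "euler (f - g) = euler f - euler g" for f g :: "'n free_algebra"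
    using euler_add[of "f - g" g] by simp
  ultimately show ?thesis using f unfolding inv_mod_def by (metis euler_act)
qed

text \<open>
  Up to terms of lower filtration degree \<open>\<Delta> r\<^sup>2 + c\<close> is \<open>r\<^sup>2 \<Delta> + c'\<close> with \<open>c' = 4 k + 2 n + c > 0\<close>,
  and \<open>(r\<^sup>2 \<Delta> + c') h = f\<close> is solved by \<open>h = (f - r\<^sup>2 y) / c'\<close> once \<open>(\<Delta> r\<^sup>2 + c') y = \<Delta> f\<close>.
\<close>

lemma lap_rsq_surj_aux:
  assumes "f \<in> filt k" "homogeneous d f" "inv_mod f"
  shows "\<exists>h\<in>filt k. homogeneous d h \<and> inv_mod h \<and> lap (rsq * h) + of_nat c * h - f \<in> J"
  using assms
proof (induction k arbitrary: f d c rule: less_induct)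
  case (less k)
  show ?case
  proof (cases k)
    case 0
    then show ?thesis
      using less.prems inv_mod_const[of 0]
      by (intro bexI[of _ 0]) (simp_all add: filt_zero zero_mem uminus_mem lap_def)
  next
    case (Suc m)
    \<comment> \<open>The value of \<open>4 * euler + 2 * n + c\<close> on top polynomial degree:
      \<open>filt k\<close> with \<open>k = Suc m\<close> has polynomial degree at most m.\<close>
    define c' where "c' = 4 * m + 2 * CARD('n) + c"
    have "c' > 0" by (simp add: c'_def)
    then have c': "complex_of_nat c' \<noteq> 0" by simp
    \<comment> \<open>The induction hypothesis is used with \<open>c'\<close> instead of
      \<open>c\<close>, hence the generalisation over \<open>c\<close>. Homogeneity is required of
      \<open>rsq * y\<close> and not of \<open>y\<close>, so that \<open>y = 0\<close> also serves
      the degrees \<open>d < 2\<close>, where \<open>lap f = 0\<close>.\<close>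
    have "\<exists>y\<in>filt (m - 1). homogeneous d (rsq * y) \<and> inv_mod y
        \<and> lap (rsq * y) + of_nat c' * y - lap f \<in> J"
    proof (cases "d < 2")
      case True
      then show ?thesis
        using lap_eq_0[OF less.prems(2)] inv_mod_const[of 0]
        by (intro bexI[of _ 0]) (simp_all add: filt_zero zero_mem lap_def)
    next
      case False
      then obtain e where e: "d = Suc (Suc e)"
        by (metis less_2_cases_iff not0_implies_Suc One_nat_def)
      have "m - 1 < k" "lap f \<in> filt (m - 1)"
        using filt_lap[OF less.prems(1)] Suc by (simp_all add: numeral_2_eq_2)
      from less.IH[OF this homogeneous_lap inv_mod_lap, of e c'] less.prems e
      show ?thesis using homogeneous_rsq_mult by blast
    qed
    then obtain y where y: "y \<in> filt (m - 1)" "homogeneous d (rsq * y)" "inv_mod y"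
      "lap (rsq * y) + of_nat c' * y - lap f \<in> J" by blast
    have "rsq * y \<in> filt k"
    proof (cases m)
      case 0
      then show ?thesis using y filt_ideal lmult_mem by auto
    next
      case (Suc l)
      then show ?thesis using filt_rsq_mult[OF y(1)] \<open>k = Suc m\<close> by simp
    qed
    define h where "h = const (1 / of_nat c') * (f - rsq * y)"
    have h: "h \<in> filt k" "homogeneous d h" "inv_mod h"
      using less.prems y \<open>rsq * y \<in> filt k\<close> unfolding h_def
      by (auto intro!: filt_const_mult filt_diff homogeneous_const_mult homogeneous_diff
          inv_mod_mult inv_mod_diff inv_mod_const inv_mod_rsq)
    have ch: "of_nat c' * h = f - rsq * y"
      using c' by (simp add: h_def flip: const_of_nat mult.assoc const_mult)
    \<comment> \<open>The equation for \<open>y\<close> says exactly that \<open>y\<close> is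
      \<open>lap h\<close> modulo \<open>J\<close>; then \<open>rsq * lap h + c' * h\<close> is
      \<open>f\<close> modulo \<open>J\<close>.\<close>
    have "const (of_nat c') * (lap h - y) = - (lap (rsq * y) + of_nat c' * y - lap f)"
      using c' by (simp add: h_def lap_const_mult lap_diff right_diff_distrib const_of_nat)
        (simp flip: const_of_nat mult.assoc const_mult)
    then have "const (of_nat c') * (lap h - y) \<in> J"
      using uminus_mem[OF y(4)] by (simp only:)
    then have lap_h: "lap h - y \<in> J"
      by (rule const_mult_cancel[OF c'])
    \<comment> \<open>The error of \<open>h\<close> in the original equation, caused by replacing
      \<open>euler\<close> by m. It drops one step in the filtration, and the induction hypothesis
      with the same \<open>c\<close> supplies a correction \<open>h'\<close>.\<close>
    define e where "e = 4 * (euler h - of_nat m * h)"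
    have e: "e \<in> filt m" "homogeneous d e" "inv_mod e"
      unfolding e_def const_of_nat[symmetric] const_numeral[symmetric]
      by (use h Suc in \<open>auto intro!: filt_const_mult filt_euler[unfolded const_of_nat[symmetric]]
        homogeneous_const_mult homogeneous_diff homogeneous_euler
        inv_mod_mult inv_mod_diff inv_mod_const inv_mod_euler simp del: filt.simps\<close>)
    have "m < k" "- e \<in> filt m" "homogeneous d (- e)" "inv_mod (- e)"
      using Suc e filt_diff[OF filt_zero e(1)] homogeneous_diff[of d 0 e]
        inv_mod_diff[OF inv_mod_const[of 0], of e] by simp_all
    from less.IH[OF this, of c] obtain h' where h': "h' \<in> filt m" "homogeneous d h'" "inv_mod h'"
      "lap (rsq * h') + of_nat c * h' + e \<in> J" by auto
    have "lap (rsq * h) + of_nat c * h - f = rsq * (lap h - y) + e"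
    proof -
      have "of_nat c' * h = 4 * (of_nat m * h) + of_nat (2 * CARD('n)) * h + of_nat c * h"
        by (simp add: c'_def distrib_right mult.assoc)
      then have "of_nat c * h + of_nat (2 * CARD('n)) * h = f - rsq * y - 4 * (of_nat m * h)"
        using ch by (simp add: algebra_simps)
      then show ?thesis
        unfolding lap_rsq_mult e_def by (simp add: algebra_simps)
    qed
    then have "lap (rsq * (h + h')) + of_nat c * (h + h') - f
        = rsq * (lap h - y) + (lap (rsq * h') + of_nat c * h' + e)"
      by (simp add: distrib_left lap_add algebra_simps)
    also have "\<dots> \<in> J" by (rule add_mem[OF lmult_mem[OF lap_h] h'(4)])
    finally have "lap (rsq * (h + h')) + of_nat c * (h + h') - f \<in> J" .
    moreover have "h + h' \<in> filt k" using h h' Suc filt_Suc filt_add by metis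
    ultimately show ?thesis using h h' homogeneous_add inv_mod_add by blast
  qed
qed

lemma lap_surj:
  assumes "homogeneous d f" "inv_mod f"
  shows "\<exists>g. homogeneous (Suc (Suc d)) g \<and> inv_mod g \<and> lap g - f \<in> J"
proof -
  obtain h where "homogeneous d h" "inv_mod h" "lap (rsq * h) - f \<in> J"
    using lap_rsq_surj_aux[OF homogeneous_filt[OF assms(1)] assms, of 0] by auto
  then show ?thesis
    using homogeneous_rsq_mult inv_mod_mult inv_mod_rsq by blast
qed

end

section \<open>Degree bound in one variable\<close>

text \<open>
  Lazard elimination of \<open>x\<^sub>j\<close> from an element of degree \<open>d\<close> in \<open>x\<^sub>j\<close>: the factors \<open>x\<^sub>j\<close> which do not
  move to the front are absorbed by commutators.
\<close>

definition lazard :: "'n \<Rightarrow> nat \<Rightarrow> 'n free_algebra \<Rightarrow> bool"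
  where "lazard j d f \<longleftrightarrow> (\<exists>c. f = (\<Sum>m\<le>d. gen j ^ m * c m) \<and>
    (\<forall>m\<le>d. ladder (gen j) (d - m) (c m) \<and> pd j (c m) = 0))"

lemma lazard_add:
  assumes "lazard j d f" "lazard j d g"
  shows "lazard j d (f + g)"
proof -
  from assms obtain c c' where
    "f = (\<Sum>m\<le>d. gen j ^ m * c m)" "\<forall>m\<le>d. ladder (gen j) (d - m) (c m) \<and> pd j (c m) = 0"
    "g = (\<Sum>m\<le>d. gen j ^ m * c' m)" "\<forall>m\<le>d. ladder (gen j) (d - m) (c' m) \<and> pd j (c' m) = 0"
    unfolding lazard_def by blast
  then show ?thesis
    unfolding lazard_def
    by (intro exI[of _ "\<lambda>m. c m + c' m"]) (simp add: distrib_left sum.distrib ladder_add pd_add)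
qed

lemma lazard_zero: "lazard j d 0"
  unfolding lazard_def by (rule exI[of _ "\<lambda>_. 0"]) (simp add: ladder_zero)

lemma lazard_const: "lazard j 0 (const c)"
  unfolding lazard_def by (rule exI[of _ "\<lambda>_. const c"]) (simp add: ladder_0)

lemma lazard_mult_free:
  assumes "lazard j d f" "pd j g = 0"
  shows "lazard j d (f * g)"
proof -
  from assms obtain c where
    "f = (\<Sum>m\<le>d. gen j ^ m * c m)" "\<forall>m\<le>d. ladder (gen j) (d - m) (c m) \<and> pd j (c m) = 0"
    unfolding lazard_def by blast
  then show ?thesis
    unfolding lazard_def
    by (intro exI[of _ "\<lambda>m. c m * g"])
      (simp add: sum_distrib_right mult.assoc ladder_rmult pd_mult assms(2))
qed

text \<open>From \<open>c x = x c + [c, x]\<close>: the first term raises the power of x by one, the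
  second climbs one rung, and in both cases power plus rung becomes \<open>Suc d\<close>.\<close>

lemma lazard_mult_gen:
  assumes "lazard j d f"
  shows "lazard j (Suc d) (f * gen j)"
proof -
  let ?x = "gen j"
  from assms obtain c where f: "f = (\<Sum>m\<le>d. ?x ^ m * c m)"
    and c: "\<And>m. m \<le> d \<Longrightarrow> ladder ?x (d - m) (c m)" "\<And>m. m \<le> d \<Longrightarrow> pd j (c m) = 0"
    unfolding lazard_def by blast
  define c1 where "c1 m = (case m of 0 \<Rightarrow> 0 | Suc m \<Rightarrow> c m)" for m
  define c2 where "c2 m = (if m \<le> d then commutator (c m) ?x else 0)" for m
  have "f * ?x = (\<Sum>m\<le>d. ?x ^ Suc m * c m + ?x ^ m * commutator (c m) ?x)"
    unfolding f sum_distrib_right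
    by (rule sum.cong) (simp_all add: commutator_def right_diff_distrib power_commutes mult.assoc
        flip: mult.assoc[of _ ?x "c _"])
  also have "\<dots> = (\<Sum>m\<le>Suc d. ?x ^ m * c1 m) + (\<Sum>m\<le>Suc d. ?x ^ m * c2 m)"
  proof -
    have "(\<Sum>m\<le>Suc d. ?x ^ m * c1 m) = (\<Sum>m\<le>d. ?x ^ Suc m * c m)"
      by (subst sum.atMost_Suc_shift) (simp add: c1_def)
    moreover have "(\<Sum>m\<le>Suc d. ?x ^ m * c2 m) = (\<Sum>m\<le>d. ?x ^ m * commutator (c m) ?x)"
      by (simp add: c2_def)
    ultimately show ?thesis by (simp only: sum.distrib)
  qed
  finally have "f * ?x = (\<Sum>m\<le>Suc d. ?x ^ m * (c1 m + c2 m))"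
    by (simp only: distrib_left sum.distrib)
  moreover have "ladder ?x (Suc d - m) (c1 m + c2 m) \<and> pd j (c1 m + c2 m) = 0" if "m \<le> Suc d" for m
  proof -
    have "ladder ?x (Suc d - m) (c1 m) \<and> pd j (c1 m) = 0"
      using that c by (auto simp: c1_def ladder_zero split: nat.split)
    moreover have "ladder ?x (Suc d - m) (c2 m) \<and> pd j (c2 m) = 0"
      using c ladder_commutator[of ?x "d - m" "c m"]
      by (auto simp: c2_def ladder_zero Suc_diff_le commutator_def pd_diff pd_mult pd_gen)
    ultimately show ?thesis by (simp add: ladder_add pd_add)
  qed
  ultimately have "f * ?x = (\<Sum>m\<le>Suc d. ?x ^ m * (c1 m + c2 m)) \<and>
      (\<forall>m\<le>Suc d. ladder ?x (Suc d - m) (c1 m + c2 m) \<and> pd j (c1 m + c2 m) = 0)"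
    by (intro conjI[of "_ = _"] allI impI)
  then show ?thesis unfolding lazard_def by (rule exI[where x = "\<lambda>m. c1 m + c2 m"])
qed

lemma lazard_supported:
  assumes "supported (\<lambda>ls. count_list ls j = d) f"
  shows "lazard j d f"
  using assms
proof (induction rule: supported_induct)
  case (monomial c ls)
  have "lazard j (count_list ls j) (const c * monomial ls)"
  proof (induction ls rule: rev_induct)
    case (snoc l ls)
    have "const c * monomial (ls @ [l]) = const c * monomial ls * gen l"
      by (simp add: monomial_append monomial_singleton mult.assoc)
    then show ?case
      using lazard_mult_gen[OF snoc] lazard_mult_free[OF snoc, of "gen l"] by (simp add: pd_gen)
  qed (simp add: lazard_const)
  with monomial show ?case by simp
qed (simp_all add: lazard_zero lazard_add)

lemma pd_gen_power: "pd j (gen j ^ Suc m) = of_nat (Suc m) * gen j ^ m"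
proof (induction m)
  case (Suc m)
  have "pd j (gen j ^ Suc (Suc m)) = gen j ^ Suc m + gen j * (of_nat (Suc m) * gen j ^ m)"
    by (subst power_Suc) (simp only: pd_gen_mult Suc simp_thms if_True)
  also have "gen j * (of_nat (Suc m) * gen j ^ m) = of_nat (Suc m) * gen j ^ Suc m"
    by (metis mult.assoc mult_of_nat_commute power_Suc)
  finally show ?case by (simp add: distrib_right)
qed (simp add: pd_gen)

locale lie_nilpotent_ideal = invariant_ideal J for J :: "'n::finite free_algebra set" +
  fixes p :: nat
  assumes left_normed_mem: "length us = p + 1 \<Longrightarrow> left_normed us \<in> J"

context invariant_ideal
begin

lemma of_nat_mult_cancel: "of_nat (Suc k) * f \<in> J \<Longrightarrow> f \<in> J"
  using const_mult_cancel[of "of_nat (Suc k)" f] of_nat_neq_0[of k, where 'a = complex]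
  by (simp only: const_of_nat) simp

text \<open>Independence of the powers of \<open>x_j\<close> over the kernel of \<open>pd j\<close>:
  differentiation removes \<open>c 0\<close> and lowers every other power, so by induction the
  remaining coefficients lie in \<open>J\<close> up to the invertible factors \<open>Suc m\<close>.
  What is left of the sum is \<open>c 0\<close>.\<close>

lemma pd_free_coefficients_mem:
  assumes "(\<Sum>m\<le>M. gen j ^ m * c m) \<in> J" "\<And>m. m \<le> M \<Longrightarrow> pd j (c m) = 0" "m \<le> M"
  shows "c m \<in> J"
  using assms
proof (induction M arbitrary: c m)
  case 0
  then show ?case by simp
next
  case (Suc M)
  have "pd j (\<Sum>m\<le>Suc M. gen j ^ m * c m) = (\<Sum>m\<le>M. gen j ^ m * (of_nat (Suc m) * c (Suc m)))"
    unfolding sum.atMost_Suc_shift pd_add pd_sum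
    using Suc.prems(2)
    by (simp add: pd_mult pd_gen_power mult_of_nat_commute mult.assoc del: of_nat_Suc power_Suc)
  then have "(\<Sum>m\<le>M. gen j ^ m * (of_nat (Suc m) * c (Suc m))) \<in> J"
    using pd_mem[OF Suc.prems(1), of j] by simp
  moreover have "pd j (of_nat (Suc m) * c (Suc m)) = 0" if "m \<le> M" for m
    using Suc.prems(2)[of "Suc m"] that pd_const_mult[of j "of_nat (Suc m)"]
    by (simp add: const_of_nat del: of_nat_Suc)
  ultimately have "of_nat (Suc m) * c (Suc m) \<in> J" if "m \<le> M" for m
    using Suc.IH[of "\<lambda>m. of_nat (Suc m) * c (Suc m)" m] that by blast
  then have c: "c (Suc m) \<in> J" if "m \<le> M" for m using that of_nat_mult_cancel by blast
  then have "(\<Sum>m\<le>M. gen j ^ Suc m * c (Suc m)) \<in> J" by (auto intro!: sum_mem lmult_mem)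
  then have "c 0 \<in> J"
    using diff_mem[OF Suc.prems(1)] by (fastforce simp: sum.atMost_Suc_shift simp del: sum.atMost_Suc)
  then show ?case using c Suc.prems(3) by (cases m) auto
qed

end

text \<open>In the Lazard form of \<open>f\<close> the coefficient \<open>c 0\<close> has climbed
  \<open>d\<close> rungs, at least p, and therefore lies in \<open>J\<close>. All other coefficients
  survive differentiation up to a nonzero factor, so they are controlled by
  \<open>pd j f\<close>.\<close>

lemma (in lie_nilpotent_ideal) degree_bound:
  assumes "supported (\<lambda>ls. count_list ls j = d) f" "pd j f \<in> J" "p \<le> d"
  shows "f \<in> J"
proof -
  from lazard_supported[OF assms(1)] obtain c where f: "f = (\<Sum>m\<le>d. gen j ^ m * c m)"
    and c: "\<And>m. m \<le> d \<Longrightarrow> ladder (gen j) (d - m) (c m)" "\<And>m. m \<le> d \<Longrightarrow> pd j (c m) = 0"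
    unfolding lazard_def by blast
  have c0: "c 0 \<in> J"
    using ladder_mem[of p "gen j" d "c 0"] left_normed_mem c(1)[of 0] assms(3) by simp
  have "c m \<in> J" if m: "m \<le> d" for m
  proof (cases m)
    case (Suc m')
    then obtain M where M: "d = Suc M" using m by (cases d) auto
    have "pd j f = (\<Sum>m\<le>M. gen j ^ m * (of_nat (Suc m) * c (Suc m)))"
      unfolding f M sum.atMost_Suc_shift pd_add pd_sum using c(2) M
      by (simp add: pd_mult pd_gen_power mult_of_nat_commute mult.assoc del: of_nat_Suc power_Suc)
    then have "of_nat (Suc m') * c (Suc m') \<in> J"
      using assms(2) c(2) M m Suc pd_const_mult[of j "of_nat (Suc _)"]
      by (intro pd_free_coefficients_mem[of j "\<lambda>m. of_nat (Suc m) * c (Suc m)" M])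
        (auto simp: const_of_nat simp del: of_nat_Suc)
    then show ?thesis using Suc of_nat_mult_cancel by blast
  qed (simp add: c0)
  then show ?thesis unfolding f by (intro sum_mem lmult_mem) simp
qed

section \<open>Polynomial families and multihomogeneous components\<close>

definition tpoly :: "(complex \<Rightarrow> 'n free_algebra) \<Rightarrow> (nat \<Rightarrow> 'n free_algebra) \<Rightarrow> bool"
  where "tpoly \<phi> c \<longleftrightarrow> (\<exists>M. (\<forall>m>M. c m = 0) \<and> (\<forall>t. \<phi> t = (\<Sum>m\<le>M. const (t ^ m) * c m)))"

lemma tpolyE:
  assumes "tpoly \<phi> c"
  obtains M where "\<And>N t. N \<ge> M \<Longrightarrow> \<phi> t = (\<Sum>m\<le>N. const (t ^ m) * c m)" "\<And>m. m > M \<Longrightarrow> c m = 0"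
proof -
  from assms obtain M where M: "\<forall>m>M. c m = 0" "\<And>t. \<phi> t = (\<Sum>m\<le>M. const (t ^ m) * c m)"
    unfolding tpoly_def by blast
  have "\<phi> t = (\<Sum>m\<le>N. const (t ^ m) * c m)" if "N \<ge> M" for N t
    unfolding M(2) using that M(1) by (intro sum.mono_neutral_left) auto
  with M(1) that show thesis by blast
qed

lemma tpoly_add:
  assumes "tpoly \<phi> c" "tpoly \<psi> d"
  shows "tpoly (\<lambda>t. \<phi> t + \<psi> t) (\<lambda>m. c m + d m)"
proof -
  obtain M where M: "\<And>N t. N \<ge> M \<Longrightarrow> \<phi> t = (\<Sum>m\<le>N. const (t ^ m) * c m)" "\<And>m. m > M \<Longrightarrow> c m = 0"
    using tpolyE[OF assms(1)] by blast
  obtain M' where M': "\<And>N t. N \<ge> M' \<Longrightarrow> \<psi> t = (\<Sum>m\<le>N. const (t ^ m) * d m)"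
    "\<And>m. m > M' \<Longrightarrow> d m = 0"
    using tpolyE[OF assms(2)] by blast
  show ?thesis
    unfolding tpoly_def
    by (intro exI[of _ "max M M'"])
      (simp add: M(1)[of "max M M'"] M'(1)[of "max M M'"] M(2) M'(2) distrib_left sum.distrib)
qed

lemma tpoly_linear:
  assumes "tpoly \<phi> c" and add: "\<And>f g. T (f + g) = T f + T g"
    and const_mult: "\<And>a f. T (const a * f) = const a * T f"
  shows "tpoly (\<lambda>t. T (\<phi> t)) (\<lambda>m. T (c m))"
proof -
  have "T 0 = 0" using const_mult[of 0 0] by simp
  have "T (sum h S) = (\<Sum>i\<in>S. T (h i))" for h and S :: "nat set"
    by (induction S rule: infinite_finite_induct) (simp_all add: add \<open>T 0 = 0\<close>)
  moreover obtain M where "\<forall>m>M. c m = 0" "\<And>t. \<phi> t = (\<Sum>m\<le>M. const (t ^ m) * c m)"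
    using assms(1) unfolding tpoly_def by blast
  ultimately show ?thesis
    unfolding tpoly_def by (intro exI[of _ M]) (simp add: \<open>T 0 = 0\<close> const_mult)
qed

lemma tpoly_shift:
  assumes "tpoly \<phi> c"
  shows "tpoly (\<lambda>t. const t * \<phi> t) (\<lambda>m. case m of 0 \<Rightarrow> 0 | Suc m \<Rightarrow> c m)"
proof -
  obtain M where M: "\<forall>m>M. c m = 0" "\<And>t. \<phi> t = (\<Sum>m\<le>M. const (t ^ m) * c m)"
    using assms unfolding tpoly_def by blast
  have "const t * \<phi> t = (\<Sum>m\<le>Suc M. const (t ^ m) * (case m of 0 \<Rightarrow> 0 | Suc m \<Rightarrow> c m))" for t
    unfolding sum.atMost_Suc_shift by (simp add: M(2) sum_distrib_left const_mult mult.assoc)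
  moreover have "(case m of 0 \<Rightarrow> 0 | Suc m \<Rightarrow> c m) = 0" if "m > Suc M" for m
    using M(1) that by (cases m) auto
  ultimately show ?thesis unfolding tpoly_def by blast
qed

lemma tpoly_const: "tpoly (\<lambda>_. f) (\<lambda>m. if m = 0 then f else 0)"
  unfolding tpoly_def by (intro exI[of _ 0]) simp

text \<open>A Vandermonde argument by elimination: with top exponent N, the family \<phi>(2 t) - 2^N
  \<phi>(t) has no coefficient at N, and its coefficient at m < N is \<open>c m\<close> times the
  nonzero number 2^m - 2^N. The top coefficient is recovered at t = 1.\<close>

lemma tpoly_coefficients_mem:
  assumes "tpoly \<phi> c" and \<phi>: "\<And>t. \<phi> t \<in> S"
    and add: "\<And>f g. f \<in> S \<Longrightarrow> g \<in> S \<Longrightarrow> f + g \<in> S"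
    and smult: "\<And>a f. f \<in> S \<Longrightarrow> const a * f \<in> S"
  shows "c m \<in> S"
proof -
  have zero: "0 \<in> S" using smult[OF \<phi>, of 0] by simp
  have sum: "sum h A \<in> S" if "\<And>i. i \<in> A \<Longrightarrow> h i \<in> S" for h and A :: "nat set"
    using that by (induction A rule: infinite_finite_induct) (simp_all add: zero add)
  obtain M where M: "\<forall>m>M. c m = 0" "\<And>t. \<phi> t = (\<Sum>m\<le>M. const (t ^ m) * c m)"
    using assms(1) unfolding tpoly_def by blast
  have "c m \<in> S" if "m \<le> M" "\<And>t. (\<Sum>m\<le>M. const (t ^ m) * c m) \<in> S" for m M c
    using that
  proof (induction M arbitrary: c m)
    case 0
    then show ?case by simp
  next
    case (Suc M)
    define d where "d m = const (2 ^ m - 2 ^ Suc M) * c m" for m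
    have "(\<Sum>m\<le>M. const (t ^ m) * d m)
        = (\<Sum>m\<le>Suc M. const ((2 * t) ^ m) * c m) + const (- (2 ^ Suc M)) * (\<Sum>m\<le>Suc M. const (t ^ m) * c m)" for t
    proof -
      have "(\<Sum>m\<le>M. const (t ^ m) * d m) = (\<Sum>m\<le>Suc M. const (t ^ m) * d m)"
        by (simp add: d_def)
      also have "\<dots> = (\<Sum>m\<le>Suc M. const ((2 * t) ^ m) * c m + const (- (2 ^ Suc M)) * (const (t ^ m) * c m))"
      proof (rule sum.cong[OF refl])
        fix m
        have "t ^ m * (2 ^ m - 2 ^ Suc M) = (2 * t) ^ m + - (2 ^ Suc M) * t ^ m"
          by (simp add: power_mult_distrib algebra_simps)
        then show "const (t ^ m) * d m
            = const ((2 * t) ^ m) * c m + const (- (2 ^ Suc M)) * (const (t ^ m) * c m)"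
          unfolding d_def mult.assoc[symmetric] const_mult[symmetric] distrib_right[symmetric]
            const_add[symmetric] by (simp only:)
      qed
      finally show ?thesis by (simp only: sum.distrib sum_distrib_left)
    qed
    then have "(\<Sum>m\<le>M. const (t ^ m) * d m) \<in> S" for t
      using Suc.prems(2) add smult by presburger
    then have d: "d m \<in> S" if "m \<le> M" for m using Suc.IH that by blast
    have c: "c m \<in> S" if "m \<le> M" for m
    proof -
      have "(2::real) ^ m \<noteq> 2 ^ Suc M" using that by (subst power_inject_exp) auto
      then have "complex_of_real (2 ^ m) \<noteq> complex_of_real (2 ^ Suc M)" by (simp only: of_real_eq_iff not_False_eq_True)
      then have "(2::complex) ^ m - 2 ^ Suc M \<noteq> 0" by simp
      then have "c m = const (1 / (2 ^ m - 2 ^ Suc M)) * d m"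
        unfolding d_def mult.assoc[symmetric] const_mult[symmetric] by simp
      then show ?thesis using d[OF that] smult by simp
    qed
    have "c (Suc M) = (\<Sum>m\<le>Suc M. const (1 ^ m) * c m) + const (-1) * (\<Sum>m\<le>M. c m)"
      by (simp add: const_uminus)
    also have "\<dots> \<in> S" using Suc.prems(2)[of 1] sum[of "{..M}" c] c smult add by blast
    finally show ?case using c Suc.prems(1) le_Suc_eq by auto
  qed
  from this[of m M c] M \<phi> show ?thesis using zero by (cases "m \<le> M") auto
qed

section \<open>Diagonal substitutions and multidegrees\<close>

definition diag :: "('n \<Rightarrow> complex) \<Rightarrow> complex ^ 'n ^ 'n"
  where "diag d = (\<chi> i j. if i = j then d i else 0)"

lemma act_diag_monomial: "act (diag d) (monomial ls) = const (prod_list (map d ls)) * monomial ls"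
proof (induction ls)
  case (Cons l ls)
  have "act (diag d) (gen l) = const (d l) * gen l"
    by (simp add: act_gen_eq_sum diag_def if_distrib[of const] if_distrib[of "\<lambda>c. c * gen _"] cong: if_cong)
  then show ?case
    by (simp add: monomial_Cons act_mult Cons const_mult mult.assoc const_left_commute[of "gen l"])
qed simp

definition word_part :: "('n list \<Rightarrow> bool) \<Rightarrow> 'n free_algebra \<Rightarrow> 'n free_algebra"
  where "word_part Q = lin_ext (\<lambda>ls. if Q ls then monomial ls else 0)"

lemma word_part_add: "word_part Q (f + g) = word_part Q f + word_part Q g"
  and word_part_const_mult: "word_part Q (const c * f) = const c * word_part Q f"
  and word_part_monomial: "word_part Q (monomial ls) = (if Q ls then monomial ls else 0)"
  by (simp_all add: word_part_def lin_ext_add lin_ext_const_mult lin_ext_monomial)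

lemma word_part_diff: "word_part Q (f - g) = word_part Q f - word_part Q g"
  using word_part_add[of Q "f - g" g] by simp

lemma linear_eqI:
  assumes "\<And>f g. S (f + g) = S f + S g" "\<And>c f. S (const c * f) = const c * S f"
    and "\<And>f g. T (f + g) = T f + T g" "\<And>c f. T (const c * f) = const c * T f"
    and "\<And>ls. S (monomial ls) = (T (monomial ls) :: 'n free_algebra)"
  shows "S f = T f"
  by (induction f rule: poly_mapping_induct_single)
    (simp_all add: single_eq_const_mult_monomial assms)

lemma word_part_word_part: "word_part Q (word_part Q' f) = word_part (\<lambda>ls. Q ls \<and> Q' ls) f"
proof (rule linear_eqI[where S = "\<lambda>f. word_part Q (word_part Q' f)"])
  fix ls
  have "word_part Q 0 = 0" using word_part_const_mult[of Q 0 0] by simp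
  then show "word_part Q (word_part Q' (monomial ls)) = word_part (\<lambda>ls. Q ls \<and> Q' ls) (monomial ls)"
    by (simp add: word_part_monomial)
qed (simp_all add: word_part_add word_part_const_mult)

lemma supported_word_part: "supported Q (word_part Q f)"
proof (induction f rule: poly_mapping_induct_single)
  case (single w c)
  then show ?case
    by (simp add: single_eq_const_mult_monomial word_part_const_mult word_part_monomial
        supported_const_mult_monomial)
qed (simp add: word_part_add supported_add)

lemma eq_sum_word_part:
  "f = (\<Sum>\<delta>\<in>(count_list \<circ> letters) ` Poly_Mapping.keys f. word_part (\<lambda>ls. count_list ls = \<delta>) f)"
proof -
  let ?g = "\<lambda>w. const (Poly_Mapping.lookup f w) * monomial (letters w)"
  have "f = (\<Sum>\<delta>\<in>(count_list \<circ> letters) ` Poly_Mapping.keys f.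
      \<Sum>w\<in>{w \<in> Poly_Mapping.keys f. (count_list \<circ> letters) w = \<delta>}. ?g w)"
    by (subst free_algebra_eq_sum, subst sum.image_gen[of _ _ "count_list \<circ> letters"]) simp_all
  also have "(\<lambda>\<delta>. \<Sum>w\<in>{w \<in> Poly_Mapping.keys f. (count_list \<circ> letters) w = \<delta>}. ?g w)
      = (\<lambda>\<delta>. word_part (\<lambda>ls. count_list ls = \<delta>) f)"
    by (rule ext) (simp add: word_part_def lin_ext_def sum.inter_filter if_distrib[of "\<lambda>c. _ * c"] cong: if_cong)
  finally show ?thesis .
qed

text \<open>Scaling \<open>x_j\<close> by t weights each word by t to its degree in
  \<open>x_j\<close>, so the parts of fixed degree are the coefficients of a polynomial
  family.\<close>

lemma tpoly_act_diag:
  "tpoly (\<lambda>t. act (diag (\<lambda>l. if l = j then t else 1)) f) (\<lambda>m. word_part (\<lambda>ls. count_list ls j = m) f)"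
proof (induction f rule: poly_mapping_induct_single)
  case (single w c)
  let ?d = "\<lambda>t l. if l = j then t else 1 :: complex" and ?n = "count_list (letters w) j"
  have pl: "prod_list (map (?d t) ls) = t ^ count_list ls j" for t ls
    by (induction ls) simp_all
  have "tpoly (\<lambda>t. const (t ^ ?n) * f) (\<lambda>m. if m = ?n then f else 0)" for f
    unfolding tpoly_def by (intro exI[of _ ?n]) (simp add: if_distrib[of "\<lambda>c. _ * c"] cong: if_cong)
  from this[of "const c * monomial (letters w)"] show ?case
    by (simp add: single_eq_const_mult_monomial act_const_mult act_diag_monomial pl
        const_left_commute[of "const (_ ^ _)"] word_part_const_mult word_part_monomial
        if_distrib[of "\<lambda>f. const c * f"] eq_commute[of ?n] cong: if_cong)
qed (auto simp: act_add word_part_add intro: tpoly_add)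

text \<open>A subspace stable under scaling single variables contains the homogeneous parts of its
  elements; the variables are treated one after another. \<open>S\<close> is arbitrary because both
  the ideal and a step of the filtration are needed.\<close>

lemma word_part_mem:
  fixes S :: "'n::finite free_algebra set"
  assumes "f \<in> S"
    and add: "\<And>f g. f \<in> S \<Longrightarrow> g \<in> S \<Longrightarrow> f + g \<in> S"
    and const_mult: "\<And>a f. f \<in> S \<Longrightarrow> const a * f \<in> S"
    and act: "\<And>A f. f \<in> S \<Longrightarrow> act A f \<in> S"
  shows "word_part (\<lambda>ls. count_list ls = \<delta>) f \<in> S"
proof -
  have "word_part (\<lambda>ls. \<forall>j\<in>V. count_list ls j = \<delta> j) f \<in> S" for V :: "'n set"
    using finite[of V]
  proof (induction V rule: finite_induct)
    case empty
    have "word_part (\<lambda>_. True) f = f"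
      by (rule linear_eqI[where T = "\<lambda>f. f"]) (simp_all add: word_part_add word_part_const_mult word_part_monomial)
    then show ?case using assms(1) by simp
  next
    case (insert j V)
    have "word_part (\<lambda>ls. count_list ls j = \<delta> j) (word_part (\<lambda>ls. \<forall>j\<in>V. count_list ls j = \<delta> j) f) \<in> S"
      by (rule tpoly_coefficients_mem[OF tpoly_act_diag _ add const_mult]) (use insert act in auto)
    then show ?case by (simp add: word_part_word_part)
  qed
  from this[of UNIV] show ?thesis by (simp add: fun_eq_iff)
qed

lemma prod_list_eq_prod_count_list:
  "prod_list (map d ls) = (\<Prod>j\<in>UNIV. d j ^ count_list ls j)" for d :: "'n::finite \<Rightarrow> complex"
proof (induction ls)
  case (Cons l ls)
  have "(\<Prod>j\<in>UNIV. d j ^ count_list (l # ls) j) = (\<Prod>j\<in>UNIV. (if j = l then d j else 1) * d j ^ count_list ls j)"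
    by (rule prod.cong) auto
  then show ?case using Cons by (simp add: prod.distrib)
qed simp

lemma word_part_act_diag:
  fixes d :: "'n::finite \<Rightarrow> complex"
  shows "word_part (\<lambda>ls. count_list ls = \<delta>) (act (diag d) f)
    = const (\<Prod>j\<in>UNIV. d j ^ \<delta> j) * word_part (\<lambda>ls. count_list ls = \<delta>) f"
proof (rule linear_eqI[where S = "\<lambda>f. word_part (\<lambda>ls. count_list ls = \<delta>) (act (diag d) f)"])
  fix c and f :: "'n free_algebra"
  show "const (\<Prod>j\<in>UNIV. d j ^ \<delta> j) * word_part (\<lambda>ls. count_list ls = \<delta>) (const c * f)
      = const c * (const (\<Prod>j\<in>UNIV. d j ^ \<delta> j) * word_part (\<lambda>ls. count_list ls = \<delta>) f)"
    unfolding word_part_const_mult by (rule const_left_commute)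
qed (simp_all add: act_add act_const_mult word_part_add word_part_const_mult distrib_left
    act_diag_monomial word_part_monomial prod_list_eq_prod_count_list)

section \<open>Directional derivatives along isotropic vectors\<close>

definition dir :: "complex ^ 'n::finite \<Rightarrow> 'n free_algebra \<Rightarrow> 'n free_algebra"
  where "dir y f = (\<Sum>j\<in>UNIV. const (y $ j) * pd j f)"

lemma dir_add: "dir y (f + g) = dir y f + dir y g"
  and dir_diff: "dir y (f - g) = dir y f - dir y g"
  by (simp_all add: dir_def pd_add pd_diff distrib_left right_diff_distrib sum.distrib sum_subtractf)

lemma dir_const_mult: "dir y (const c * f) = const c * dir y f"
  by (simp add: dir_def pd_const_mult sum_distrib_left const_left_commute[of "const c"])

lemma dir_0 [simp]: "dir y 0 = 0"
  by (simp add: dir_def)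

lemma dir_sum: "dir y (sum f S) = (\<Sum>i\<in>S. dir y (f i))"
  by (induction S rule: infinite_finite_induct) (simp_all add: dir_add)

lemma dir_vec_add: "dir (y + z) f = dir y f + dir z f"
  and dir_vec_diff: "dir (y - z) f = dir y f - dir z f"
  by (simp_all add: dir_def const_add const_diff distrib_right left_diff_distrib sum.distrib sum_subtractf)

lemma dir_vec_scale: "dir (c *s y) f = const c * dir y f"
  by (simp add: dir_def const_mult sum_distrib_left mult.assoc)

lemma dir_axis: "dir (axis j 1) f = pd j f"
  by (simp add: dir_def axis_def if_distrib[of const] if_distrib[of "\<lambda>c. c * pd _ f"] cong: if_cong)

lemma pd_dir: "pd j (dir y f) = dir y (pd j f)"
  by (simp add: dir_def pd_sum pd_const_mult pd_commute[of j])

lemma dir_commute: "dir y (dir z f) = dir z (dir y f)"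
proof -
  have "dir y (dir z f) = (\<Sum>j\<in>UNIV. const (z $ j) * dir y (pd j f))"
    by (simp add: dir_def[of z] dir_sum dir_const_mult)
  also have "\<dots> = dir z (dir y f)"
    by (simp add: dir_def[of z] pd_dir)
  finally show ?thesis .
qed

lemma pd_dir_power: "pd j ((dir y ^^ k) f) = (dir y ^^ k) (pd j f)"
  by (induction k) (simp_all add: pd_dir)

lemma dir_lap: "dir y (lap f) = lap (dir y f)"
  by (simp add: lap_def pd_dir dir_sum)

text \<open>Directional derivatives commute, so this is the expansion of the k-th power of
  \<open>dir y + t dir v + t^2 dir w\<close> up to second order. The truncated exponents
  \<open>k - 1\<close> and \<open>k - 2\<close> are harmless: where truncation occurs, the factors k
  and \<open>k choose 2\<close> are zero.\<close>

lemma tpoly_dir_power: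
  "\<exists>c. tpoly (\<lambda>t. (dir (y + t *s v + (t * t) *s w) ^^ k) u) c
    \<and> c 0 = (dir y ^^ k) u
    \<and> c 1 = const (of_nat k) * dir v ((dir y ^^ (k - 1)) u)
    \<and> c 2 = const (of_nat (k choose 2)) * dir v (dir v ((dir y ^^ (k - 2)) u))
      + const (of_nat k) * dir w ((dir y ^^ (k - 1)) u)"
proof (induction k)
  case 0
  show ?case
    by (rule exI[of _ "\<lambda>m. if m = 0 then u else 0"]) (simp add: tpoly_const binomial_eq_0)
next
  case (Suc k)
  let ?X = "\<lambda>k. (dir y ^^ k) u"
  from Suc obtain c where c: "tpoly (\<lambda>t. (dir (y + t *s v + (t * t) *s w) ^^ k) u) c"
    "c 0 = ?X k" "c 1 = const (of_nat k) * dir v (?X (k - 1))"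
    "c 2 = const (of_nat (k choose 2)) * dir v (dir v (?X (k - 2)))
      + const (of_nat k) * dir w (?X (k - 1))" by blast
  define c' where "c' m = dir y (c m) + ((case m of 0 \<Rightarrow> 0 | Suc m \<Rightarrow> dir v (c m))
    + (case m of 0 \<Rightarrow> 0 | Suc m \<Rightarrow> (case m of 0 \<Rightarrow> 0 | Suc m \<Rightarrow> dir w (c m))))" for m
  let ?\<phi> = "\<lambda>t. (dir (y + t *s v + (t * t) *s w) ^^ k) u"
  have lin: "tpoly (\<lambda>t. dir x (?\<phi> t)) (\<lambda>m. dir x (c m))" for x
    by (rule tpoly_linear[OF c(1)]) (simp_all add: dir_add dir_const_mult)
  have "(dir (y + t *s v + (t * t) *s w) ^^ Suc k) u
      = dir y (?\<phi> t) + (const t * dir v (?\<phi> t) + const t * (const t * dir w (?\<phi> t)))" for t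
    by (simp add: dir_vec_add dir_vec_scale const_mult mult.assoc add.assoc)
  then have "tpoly (\<lambda>t. (dir (y + t *s v + (t * t) *s w) ^^ Suc k) u) c'"
    using tpoly_add[OF lin[of y] tpoly_add[OF tpoly_shift[OF lin[of v]] tpoly_shift[OF tpoly_shift[OF lin[of w]]]]]
    unfolding c'_def by simp
  moreover have "c' 0 = ?X (Suc k)" by (simp add: c'_def c(2))
  moreover have X1: "const (of_nat k) * g (dir y (?X (k - 1))) = const (of_nat k) * g (?X k)" for g
    by (cases k) simp_all
  have "c' 1 = const (of_nat (Suc k)) * dir v (?X k)"
    using X1[of "dir v"] c(3)
    by (simp add: c'_def c(2) dir_const_mult dir_commute[of y v] const_add distrib_right)
  moreover have X2: "const (of_nat (k choose 2)) * g (dir y (?X (k - 2)))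
      = const (of_nat (k choose 2)) * g (?X (k - 1))" for g
  proof (cases "k < 2")
    case False
    then obtain l where "k = Suc (Suc l)" by (metis add_2_eq_Suc le_Suc_ex not_less)
    then show ?thesis by simp
  qed (simp add: binomial_eq_0)
  have "c' 2 = const (of_nat (Suc k choose 2)) * dir v (dir v (?X (k - 1)))
      + const (of_nat (Suc k)) * dir w (?X k)"
  proof -
    have "c' 2 = dir y (c 2) + (dir v (c 1) + dir w (c 0))"
      by (simp add: c'_def numeral_2_eq_2)
    also have "dir y (c 2) = const (of_nat (k choose 2)) * dir v (dir v (?X (k - 1)))
        + const (of_nat k) * dir w (?X k)"
      using X2[of "\<lambda>f. dir v (dir v f)"] X1[of "dir w"] unfolding c(4)
      by (simp add: dir_add dir_const_mult dir_commute[of y])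
    also have "(Suc k choose 2) = k + (k choose 2)"
      by (simp add: numeral_2_eq_2)
    ultimately show ?thesis
      by (simp add: c(2) c(3)[unfolded One_nat_def] dir_const_mult const_add distrib_right add_ac)
  qed
  ultimately show ?case by (intro exI[of _ c']) (simp add: numeral_2_eq_2)
qed

section \<open>The bilinear form and isotropic vectors\<close>

lemma bilin_add_left: "bilin (u + u') v = bilin u v + bilin u' v"
  and bilin_add_right: "bilin u (v + v') = bilin u v + bilin u v'"
  and bilin_diff_left: "bilin (u - u') v = bilin u v - bilin u' v"
  and bilin_diff_right: "bilin u (v - v') = bilin u v - bilin u v'"
  and bilin_scale_left: "bilin (c *s u) v = c * bilin u v"
  and bilin_scale_right: "bilin u (c *s v) = c * bilin u v"
  by (simp_all add: bilin_def sum.distrib sum_subtractf sum_distrib_left algebra_simps)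

lemmas bilin_expand = bilin_add_left bilin_add_right bilin_diff_left bilin_diff_right
  bilin_scale_left bilin_scale_right

lemma bilin_commute: "bilin u v = bilin v u"
  by (simp add: bilin_def mult.commute)

lemma bilin_zero_left [simp]: "bilin 0 v = 0"
  by (simp add: bilin_def)

lemma bilin_axis_left: "bilin (axis j 1) v = v $ j"
  by (simp add: bilin_def axis_def if_distrib[of "\<lambda>c. c * _"] cong: if_cong)

text \<open>Provides the partner of an isotropic vector: the conjugate is isotropic too, and its
  pairing with the vector is the Hermitian norm, hence nonzero.\<close>

definition conj_vec :: "complex ^ 'n \<Rightarrow> complex ^ 'n"
  where "conj_vec y = (\<chi> j. cnj (y $ j))"

lemma bilin_conj_vec_self: "bilin (conj_vec y) (conj_vec y) = cnj (bilin y y)"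
  by (simp add: bilin_def conj_vec_def)

lemma bilin_conj_vec_neq_0:
  fixes y :: "complex ^ 'n::finite"
  assumes "y \<noteq> 0"
  shows "bilin y (conj_vec y) \<noteq> 0"
proof -
  obtain j where "y $ j \<noteq> 0" using assms by (auto simp: vec_eq_iff)
  then have "0 < (\<Sum>j\<in>UNIV. (norm (y $ j))\<^sup>2)"
    by (intro sum_pos2[of _ j]) auto
  moreover have "bilin y (conj_vec y) = of_real (\<Sum>j\<in>UNIV. (norm (y $ j))\<^sup>2)"
    by (simp add: bilin_def conj_vec_def complex_norm_square del: of_real_power)
  ultimately show ?thesis by (metis of_real_eq_0_iff less_irrefl)
qed

lemma exists_isotropic:
  assumes "CARD('n::finite) \<ge> 2"
  obtains y :: "complex ^ 'n" where "y \<noteq> 0" "bilin y y = 0"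
proof -
  obtain a b :: 'n where "a \<noteq> b"
    using assms by (metis card_2_iff' card_le_Suc0_iff_eq finite not_less_eq_eq numeral_2_eq_2 UNIV_I)
  let ?y = "axis a 1 + \<i> *s axis b 1 :: complex ^ 'n"
  have "?y $ a = 1" using \<open>a \<noteq> b\<close> by (simp add: axis_def)
  then have "?y \<noteq> 0" by (metis zero_index zero_neq_one)
  moreover have "bilin ?y ?y = 0"
    unfolding bilin_expand bilin_axis_left using \<open>a \<noteq> b\<close> by (simp add: axis_def)
  ultimately show thesis by (rule that)
qed

text \<open>
  If \<open>\<partial>\<^sub>y\<^sup>k u\<close> vanishes on the isotropic cone, differentiation along the curves
  \<open>y + t v - t\<^sup>2 (v \<cdot> v) / (2 c) \<bar>y\<close> in the cone, where \<open>c = y \<cdot> \<bar>y\<close> and \<open>v\<close> is orthogonal to \<open>y\<close> and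
  \<open>\<bar>y\<close>, gives \<open>\<partial>\<^sub>v \<partial>\<^sub>y\<^sup>k\<^sup>-\<^sup>1 u = 0\<close>. The second derivatives, summed over the projections \<open>v\<close> of the basis
  vectors, give a nonzero multiple of \<open>\<partial>\<^sub>w \<partial>\<^sub>y\<^sup>k\<^sup>-\<^sup>1 u\<close> with \<open>w = \<bar>y\<close> because \<open>u\<close> is harmonic.
\<close>

lemma (in invariant_ideal) harmonic_filt:
  assumes "CARD('n) \<ge> 2" and "lap u \<in> J"
    and "\<And>y. y \<noteq> 0 \<Longrightarrow> bilin y y = 0 \<Longrightarrow> (dir y ^^ k) u \<in> J"
  shows "u \<in> filt k"
  using assms(2,3)
proof (induction k arbitrary: u)
  case 0
  \<comment> \<open>For \<open>k = 0\<close> the hypothesis is membership of \<open>u\<close>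
    itself, provided that an isotropic vector exists; this is where \<open>n \<ge> 2\<close>
    enters.\<close>
  then show ?case using exists_isotropic[OF assms(1)] by (metis filt.simps(1) funpow_0)
next
  case (Suc k)
  \<comment> \<open>The induction passes to the derivatives \<open>pd j u\<close>. Since
    \<open>axis j 1 = v j + a j *s y + b j *s z\<close>, it is enough to treat the directions
    \<open>v j\<close>, \<open>y\<close> and \<open>z\<close>.\<close>
  have "(dir y ^^ k) (pd j u) \<in> J" if y: "y \<noteq> 0" "bilin y y = 0" for y j
  proof -
    define z where "z = conj_vec y"
    define c where "c = bilin y z"
    define g where "g = (dir y ^^ k) u"
    have c: "c \<noteq> 0" using bilin_conj_vec_neq_0[OF y(1)] by (simp add: c_def z_def)
    have zz: "bilin z z = 0" using y(2) by (simp add: z_def bilin_conj_vec_self)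
    have zy: "bilin z y = c" by (simp add: c_def bilin_commute)
    have "z \<noteq> 0" using zy c by auto
    define a where "a j = z $ j / c" for j
    define b where "b j = y $ j / c" for j
    define v where "v j = axis j 1 - a j *s y - b j *s z" for j
    have vy: "bilin (v j) y = 0" and vz: "bilin (v j) z = 0" for j
      using c by (simp_all add: v_def bilin_expand bilin_axis_left y(2) zz zy a_def b_def flip: c_def)
    have yv: "bilin y (v j) = 0" and zv: "bilin z (v j) = 0" for j
      using vy vz by (simp_all add: bilin_commute)
    define s where "s j = bilin (v j) (v j) / (2 * c)" for j
    have s: "2 * (s j * c) = bilin (v j) (v j)" for j using c by (simp add: s_def)
    \<comment> \<open>The numbers \<open>bilin (v j) (v j)\<close> add up to n - 2, the trace of the
      projection onto the orthogonal complement of \<open>y\<close> and \<open>z\<close>.\<close>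
    have sum_s: "(\<Sum>j\<in>UNIV. s j) = (of_nat CARD('n) - 2) / (2 * c)"
    proof -
      have "bilin (v j) (v j) = 1 - 2 * (y $ j * z $ j) / c" for j
      proof -
        have "bilin (v j) (v j) = bilin (axis j 1) (v j)"
          using yv zv by (subst (1) v_def) (simp add: bilin_diff_left bilin_scale_left)
        then show ?thesis
          using c by (simp add: bilin_axis_left) (simp add: v_def a_def b_def field_simps axis_def)
      qed
      then have "(\<Sum>j\<in>UNIV. bilin (v j) (v j)) = of_nat CARD('n) - 2 * bilin y z / c"
        by (simp add: sum_subtractf bilin_def sum_distrib_left sum_divide_distrib)
      then show ?thesis using c by (simp add: s_def c_def flip: sum_divide_distrib)
    qed
    have dir_v: "dir (v j) f = pd j f - const (a j) * dir y f - const (b j) * dir z f" for j f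
      by (simp add: v_def dir_vec_diff dir_vec_scale dir_axis)
    have yg: "dir y g \<in> J" using Suc.prems(2)[OF y] by (simp add: g_def)
    have coefficients:
      "const (of_nat (Suc k)) * dir (v j) g \<in> J"
      "const (of_nat (Suc k choose 2)) * dir (v j) (dir (v j) ((dir y ^^ (k - 1)) u))
        + const (of_nat (Suc k)) * dir (- s j *s z) g \<in> J" for j
    proof -
      have "(dir (y + t *s v j + (t * t) *s (- s j *s z)) ^^ Suc k) u \<in> J" for t
      proof (rule Suc.prems(2))
        let ?y = "y + t *s v j + (t * t) *s (- s j *s z)"
        have "bilin ?y z = c"
          unfolding bilin_expand vz zz by (simp add: c_def)
        then show "?y \<noteq> 0" using c by auto
        have "bilin ?y ?y = t * t * (bilin (v j) (v j) - 2 * (s j * c))"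
          unfolding bilin_expand vz zz vy yv zv y(2) zy by (simp add: algebra_simps flip: c_def)
        then show "bilin ?y ?y = 0" by (simp add: s)
      qed
      moreover obtain h where h: "tpoly (\<lambda>t. (dir (y + t *s v j + (t * t) *s (- s j *s z)) ^^ Suc k) u) h"
        "h 1 = const (of_nat (Suc k)) * dir (v j) g"
        "h 2 = const (of_nat (Suc k choose 2)) * dir (v j) (dir (v j) ((dir y ^^ (k - 1)) u))
          + const (of_nat (Suc k)) * dir (- s j *s z) g"
        using tpoly_dir_power[where y = y and v = "v j" and w = "- s j *s z" and k = "Suc k" and u = u] by (auto simp: g_def numeral_2_eq_2)
      ultimately have "h m \<in> J" for m
        using tpoly_coefficients_mem[OF h(1), of J m] add_mem lmult_mem by blast
      from this[of 1] this[of 2] show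
        "const (of_nat (Suc k)) * dir (v j) g \<in> J"
        "const (of_nat (Suc k choose 2)) * dir (v j) (dir (v j) ((dir y ^^ (k - 1)) u))
          + const (of_nat (Suc k)) * dir (- s j *s z) g \<in> J"
        by (simp_all only: h(2,3))
    qed
    have vg: "dir (v j) g \<in> J" for j
      using coefficients(1) of_nat_neq_0[of k, where 'a = complex] by (rule const_mult_cancel[rotated])
    have zg: "dir z g \<in> J"
    \<comment> \<open>For \<open>k = 0\<close> the numerical factor found below vanishes when n = 2;
      instead the hypothesis is applied to \<open>z\<close>, which is isotropic itself.\<close>
    proof (cases k)
      case 0
      then show ?thesis using Suc.prems(2)[OF \<open>z \<noteq> 0\<close> zz] by (simp add: g_def)
    next
      case (Suc l)
      define h where "h = (dir y ^^ l) u"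
      have g: "g = dir y h" by (simp add: g_def h_def Suc)
      have lap_h: "lap h \<in> J"
      proof -
        have "lap ((dir y ^^ l) u) = (dir y ^^ l) (lap u)"
          by (induction l) (simp_all flip: dir_lap)
        moreover have "(dir y ^^ l) f \<in> J" if "f \<in> J" for f
          using that by (induction l) (auto simp: dir_def intro!: sum_mem lmult_mem pd_mem)
        ultimately show ?thesis using Suc.prems(1) by (simp add: h_def)
      qed
      have "dir (v j) (dir (v j) h) = pd j (pd j h)
          - (const (a j) * pd j (dir y h) + const (a j) * pd j (dir y h)
            + (const (b j) * pd j (dir z h) + const (b j) * pd j (dir z h)))
          + const (a j * a j) * dir y (dir y h)
          + (const (a j * b j) * dir y (dir z h) + const (a j * b j) * dir y (dir z h))
          + const (b j * b j) * dir z (dir z h)" for j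
      proof -
        have cc: "const d * (const e * f) = const (d * e) * f" for d e and f :: "'n free_algebra"
          by (simp add: const_mult mult.assoc)
        show ?thesis
          by (simp add: dir_v pd_diff pd_const_mult dir_diff dir_const_mult right_diff_distrib cc
              dir_commute[of z y] const_add distrib_right mult.commute[of "b j" "a j"] pd_dir)
      qed
      moreover have "(\<Sum>j\<in>UNIV. const (a j) * pd j f) = const (1 / c) * dir z f"
        "(\<Sum>j\<in>UNIV. const (b j) * pd j f) = const (1 / c) * dir y f" for f
        by (simp_all add: a_def b_def dir_def sum_distrib_left flip: mult.assoc const_mult)
      moreover have "(\<Sum>j\<in>UNIV. a j * a j) = 0" "(\<Sum>j\<in>UNIV. b j * b j) = 0"
        "(\<Sum>j\<in>UNIV. a j * b j) = 1 / c"
      proof -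
        have "(\<Sum>j\<in>UNIV. a j * a j) = bilin z z / (c * c)" "(\<Sum>j\<in>UNIV. b j * b j) = bilin y y / (c * c)"
          "(\<Sum>j\<in>UNIV. a j * b j) = bilin z y / (c * c)"
          by (simp_all add: a_def b_def bilin_def sum_divide_distrib)
        then show "(\<Sum>j\<in>UNIV. a j * a j) = 0" "(\<Sum>j\<in>UNIV. b j * b j) = 0"
          "(\<Sum>j\<in>UNIV. a j * b j) = 1 / c"
          using c by (simp_all add: zz zy y(2))
      qed
      \<comment> \<open>In coordinates adapted to \<open>y\<close>, \<open>z\<close> and their
        complement, the Laplacian is the sum of the second derivatives along the \<open>v j\<close>
        plus \<open>(2 / c) dir y dir z\<close>.\<close>
      ultimately have sum_vv: "(\<Sum>j\<in>UNIV. dir (v j) (dir (v j) h))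
          = lap h - (const (1 / c) * dir z g + const (1 / c) * dir z g)"
        by (simp add: sum.distrib sum_subtractf g dir_commute[of y z] lap_def
            flip: sum_distrib_right const_sum)
      let ?N = "of_nat (Suc k choose 2) :: complex"
      have "(\<Sum>j\<in>UNIV. const ?N * dir (v j) (dir (v j) h) + const (of_nat (Suc k)) * dir (- s j *s z) g) \<in> J"
        using coefficients(2) Suc by (intro sum_mem) (simp add: h_def)
      also have "(\<Sum>j\<in>UNIV. const ?N * dir (v j) (dir (v j) h) + const (of_nat (Suc k)) * dir (- s j *s z) g)
          = const ?N * (\<Sum>j\<in>UNIV. dir (v j) (dir (v j) h))
            + const (- (of_nat (Suc k) * (\<Sum>j\<in>UNIV. s j))) * dir z g"
      proof -
        have "(\<Sum>j\<in>UNIV. const (of_nat (Suc k)) * dir (- s j *s z) g)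
            = (\<Sum>j\<in>UNIV. const (of_nat (Suc k) * - s j)) * dir z g"
          unfolding sum_distrib_right dir_vec_scale const_mult mult.assoc ..
        also have "\<dots> = const (- (of_nat (Suc k) * (\<Sum>j\<in>UNIV. s j))) * dir z g"
          by (simp add: sum_distrib_left sum_negf flip: const_sum)
        finally show ?thesis by (simp only: sum.distrib sum_distrib_left)
      qed
      also have "\<dots> = const ?N * lap h
          + const (- (?N * (1 / c)) - ?N * (1 / c) - of_nat (Suc k) * (\<Sum>j\<in>UNIV. s j)) * dir z g"
      proof -
        have "const n * (f - (const d * f' + const d * f')) + const (- e) * f'
            = const n * f + const (- (n * d) - n * d - e) * f'" for n d e and f f' :: "'n free_algebra"
          unfolding const_diff const_uminus const_mult
          by (simp add: distrib_left right_diff_distrib left_diff_distrib mult.assoc)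
        then show ?thesis unfolding sum_vv .
      qed
      finally have "const (- (?N * (1 / c)) - ?N * (1 / c) - of_nat (Suc k) * (\<Sum>j\<in>UNIV. s j)) * dir z g \<in> J"
        using diff_mem[OF _ lmult_mem[OF lap_h, of "const ?N"]] by fastforce
      \<comment> \<open>The factor equals \<open>- (k + 1) (2 k + n - 2) / (2 c)\<close>, and k is
        at least 1 in this case.\<close>
      moreover have "- (?N * (1 / c)) - ?N * (1 / c) - of_nat (Suc k) * (\<Sum>j\<in>UNIV. s j) \<noteq> 0"
      proof -
        have "2 * (Suc k choose 2) = Suc k * k" by (simp add: choose_two)
        then have "2 * ?N = of_nat (Suc k) * of_nat k" by (metis of_nat_mult of_nat_numeral)
        then have "- (?N * (1 / c)) - ?N * (1 / c) - of_nat (Suc k) * (\<Sum>j\<in>UNIV. s j)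
            = - (of_nat (Suc k) * (of_nat (2 * k + CARD('n)) - 2)) / (2 * c)"
          unfolding sum_s using c by (simp add: field_simps del: of_nat_Suc)
        moreover have "of_nat (2 * k + CARD('n)) - (2 :: complex) = of_nat (2 * k + CARD('n) - 2)"
          using Suc by (subst of_nat_diff) auto
        moreover have "of_nat (2 * k + CARD('n) - 2) \<noteq> (0 :: complex)"
          unfolding of_nat_eq_0_iff using Suc zero_less_card_finite[where 'a = 'n] by simp
        moreover have "of_nat (Suc k) \<noteq> (0 :: complex)" by (rule of_nat_neq_0)
        ultimately show ?thesis
          using c by (simp only: divide_eq_0_iff neg_equal_0_iff_equal mult_eq_0_iff zero_neq_numeral[symmetric]) blast
      qed
      ultimately show ?thesis by (metis const_mult_cancel)
    qed
    have "pd j g = dir (v j) g + (const (a j) * dir y g + const (b j) * dir z g)" by (simp add: dir_v)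
    then have "pd j g \<in> J" using vg yg zg by (simp add: add_mem lmult_mem)
    then show ?thesis by (simp add: g_def pd_dir_power)
  qed
  moreover have "lap (pd j u) \<in> J" for j using pd_mem[OF Suc.prems(1)] by (simp add: pd_lap)
  ultimately show ?case using Suc.IH by simp
qed

section \<open>Invariant harmonic elements\<close>

text \<open>If all these minors vanished, \<open>y $ a\<close> times the pairing of y with its
  conjugate would be a multiple of \<open>bilin y y = 0\<close>. The two indices are the places
  where y and its conjugate can replace standard basis vectors.\<close>

lemma isotropic_independent:
  assumes "y \<noteq> 0" "bilin y y = 0"
  obtains a b where "y $ a * conj_vec y $ b \<noteq> y $ b * conj_vec y $ a"
proof (rule ccontr)
  assume "\<not> thesis"
  with that have eq: "y $ a * conj_vec y $ b = y $ b * conj_vec y $ a" for a b by blast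
  obtain a where "y $ a \<noteq> 0" using assms(1) by (auto simp: vec_eq_iff)
  have "y $ a * bilin y (conj_vec y) = (\<Sum>b\<in>UNIV. y $ b * (y $ a * conj_vec y $ b))"
    by (simp add: bilin_def sum_distrib_left mult_ac)
  also have "\<dots> = conj_vec y $ a * bilin y y"
    unfolding eq by (simp add: bilin_def sum_distrib_left mult_ac)
  finally show False
    using bilin_conj_vec_neq_0[OF assms(1)] \<open>y $ a \<noteq> 0\<close> assms(2) by simp
qed

text \<open>
  The basis consists of \<open>y\<close> and \<open>\<bar>y\<close>, placed at two indices \<open>a\<close> and \<open>b\<close>, and the projections of the
  other basis vectors to the orthogonal complement of \<open>y\<close> and \<open>\<bar>y\<close>.
\<close>

lemma isotropic_basis:
  fixes y :: "complex ^ 'n::finite"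
  assumes "y \<noteq> 0" "bilin y y = 0"
  obtains a b :: 'n and g h :: "complex ^ 'n ^ 'n" and \<kappa>
  where "a \<noteq> b" "g ** h = mat 1" "h ** g = mat 1" "\<kappa> \<noteq> 0"
    "\<And>x. (h *v x) $ b = \<kappa> * bilin x y"
    "\<And>d. d a * d b = 1 \<Longrightarrow> (\<And>j. j \<noteq> a \<Longrightarrow> j \<noteq> b \<Longrightarrow> d j = 1) \<Longrightarrow> g ** diag d ** h \<in> SO"
proof -
  define z where "z = conj_vec y"
  define c where "c = bilin y z"
  have c: "c \<noteq> 0" using bilin_conj_vec_neq_0[OF assms(1)] by (simp add: c_def z_def)
  have zz: "bilin z z = 0" using assms(2) by (simp add: z_def bilin_conj_vec_self)
  have zy: "bilin z y = c" by (simp add: c_def bilin_commute)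
  obtain a b where ab: "y $ a * z $ b \<noteq> y $ b * z $ a"
    using isotropic_independent[OF assms] unfolding z_def by metis
  then have "a \<noteq> b" by auto
  define P where "P v = v - (bilin v z / c) *s y - (bilin v y / c) *s z" for v
  have Py: "bilin (P v) y = 0" and Pz: "bilin (P v) z = 0" for v
    using c by (simp_all add: P_def bilin_expand assms(2) zz zy flip: c_def)
  have yP: "bilin y (P v) = 0" and zP: "bilin z (P v) = 0" for v
    using Py Pz by (simp_all add: bilin_commute)
  define R :: "complex ^ 'n \<Rightarrow> complex ^ 'n" where "R x = (\<chi> j. if j = a \<or> j = b then 0 else x $ j)" for x
  define L where "L x = x $ a *s y + x $ b *s z + P (R x)" for x
  have P_add: "P (u + v) = P u + P v" and P_scale: "P (r *s u) = r *s P u" for u v r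
    by (simp_all add: P_def bilin_expand vec_eq_iff algebra_simps add_divide_distrib)
  have R_add: "R (u + v) = R u + R v" and R_scale: "R (r *s u) = r *s R u" for u v r
    by (simp_all add: R_def vec_eq_iff)
  have "Vector_Spaces.linear (*s) (*s) L"
    unfolding Vector_Spaces.linear_iff
    by (auto simp: vec.vector_space_axioms L_def P_add P_scale R_add R_scale vec_eq_iff
        algebra_simps)
  define g where "g = matrix L"
  have g: "g *v x = L x" for x
    unfolding g_def by (rule matrix_works) fact
  have Ly: "bilin (L x) y = x $ b * c" and Lz: "bilin (L x) z = x $ a * c" for x
    by (simp_all add: L_def bilin_expand Py Pz assms(2) zz zy flip: c_def)
  \<comment> \<open>Pairing \<open>L x = 0\<close> with \<open>y\<close> and \<open>z\<close> gives
    \<open>x $ b = x $ a = 0\<close>. Then \<open>P x = 0\<close>, so x is a combination of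
    \<open>y\<close> and \<open>z\<close> vanishing at both indices, and the nonzero minor makes it
    trivial.\<close>
  have "x = 0" if "g *v x = 0" for x
  proof -
    have Lx: "L x = 0" using that g by simp
    then have xab: "x $ a = 0" "x $ b = 0" using Ly[of x] Lz[of x] c by auto
    then have "R x = x" by (auto simp: R_def vec_eq_iff)
    define r s where "r = bilin x z / c" and "s = bilin x y / c"
    have x: "x = r *s y + s *s z"
      using Lx xab \<open>R x = x\<close> by (simp add: L_def P_def r_def s_def algebra_simps)
    then have rs: "r * y $ a + s * z $ a = 0" "r * y $ b + s * z $ b = 0"
      using xab by (metis vector_add_component vector_smult_component)+
    have "r * (y $ a * z $ b - y $ b * z $ a)
        = (r * y $ a + s * z $ a) * z $ b - (r * y $ b + s * z $ b) * z $ a"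
      "s * (y $ a * z $ b - y $ b * z $ a)
        = (r * y $ b + s * z $ b) * y $ a - (r * y $ a + s * z $ a) * y $ b"
      by (simp_all add: algebra_simps)
    then have "r * (y $ a * z $ b - y $ b * z $ a) = 0" "s * (y $ a * z $ b - y $ b * z $ a) = 0"
      by (simp_all only: rs mult_zero_left diff_self)
    then have "r = 0" "s = 0" using ab by auto
    then show "x = 0" using x by simp
  qed
  then obtain h where hg: "h ** g = mat 1" using matrix_left_invertible_ker by blast
  then have gh: "g ** h = mat 1" by (simp add: matrix_left_right_inverse)
  have Lh: "L (h *v x) = x" for x
    by (simp add: matrix_vector_mul_assoc gh flip: g)
  \<comment> \<open>The coordinate along \<open>z\<close> is read off by pairing with
    \<open>y\<close>. Row b of \<open>h\<close> is thus a multiple of \<open>y\<close>, which by the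
    chain rule turns \<open>pd b\<close> into the derivative along \<open>y\<close>.\<close>
  have "(h *v x) $ b = (1 / c) * bilin x y" for x
    using Ly[of "h *v x"] c by (simp add: Lh)
  \<comment> \<open>The form on the plane of \<open>y\<close> and \<open>z\<close> contains only the
    mixed products of their coordinates, so inverse scalings preserve it; the complement is left
    fixed.\<close>
  moreover have "g ** diag d ** h \<in> SO" if d: "d a * d b = 1" "\<And>j. j \<noteq> a \<Longrightarrow> j \<noteq> b \<Longrightarrow> d j = 1" for d
  proof -
    have bilin_L: "bilin (L x) (L x') = c * (x $ a * x' $ b + x $ b * x' $ a) + bilin (P (R x)) (P (R x'))"
      for x x'
      unfolding L_def bilin_expand Py Pz yP zP assms(2) zz zy by (simp add: algebra_simps flip: c_def)
    have diag: "(diag d *v x) $ j = d j * x $ j" for x j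
      by (simp add: diag_def matrix_vector_mult_def if_distrib[of "\<lambda>c. c * _"] cong: if_cong)
    have R_diag: "R (diag d *v x) = R x" for x
      using d(2) by (auto simp: R_def vec_eq_iff diag)
    have "bilin ((g ** diag d ** h) *v u) ((g ** diag d ** h) *v v) = bilin u v" for u v
    proof -
      have "bilin ((g ** diag d ** h) *v u) ((g ** diag d ** h) *v v)
          = bilin (L (diag d *v (h *v u))) (L (diag d *v (h *v v)))"
        by (simp only: g flip: matrix_vector_mul_assoc)
      also have "\<dots> = c * ((d a * d b) * ((h *v u) $ a * (h *v v) $ b + (h *v u) $ b * (h *v v) $ a))
          + bilin (P (R (h *v u))) (P (R (h *v v)))"
        unfolding bilin_L diag R_diag by (simp add: algebra_simps)
      also have "\<dots> = bilin (L (h *v u)) (L (h *v v))" unfolding bilin_L d(1) by simp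
      finally show ?thesis by (simp only: Lh)
    qed
    moreover have "det (g ** diag d ** h) = 1"
    proof -
      have "det (diag d) = (\<Prod>j\<in>UNIV. d j)"
        by (subst det_diagonal) (simp_all add: diag_def)
      also have "\<dots> = (\<Prod>j\<in>{a, b}. d j)"
        using d(2) by (intro prod.mono_neutral_right) auto
      also have "\<dots> = 1" using d(1) \<open>a \<noteq> b\<close> by simp
      finally have "det (g ** diag d ** h) = det (g ** h)" by (simp add: det_mul)
      then show ?thesis by (simp add: gh)
    qed
    ultimately show ?thesis by (simp add: SO_def)
  qed
  ultimately show thesis using that[of a b g h "1 / c"] \<open>a \<noteq> b\<close> gh hg c by simp
qed

lemma pd_power_add: "(pd j ^^ k) (f + g) = (pd j ^^ k) f + (pd j ^^ k) g"
  by (induction k) (simp_all add: pd_add)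

lemma supported_pd_power:
  assumes "supported (\<lambda>ls. count_list ls = \<delta>) f"
  shows "supported (\<lambda>ls. \<forall>j. count_list ls j + (if j = b then k else 0) = \<delta> j) ((pd b ^^ k) f)"
proof (induction k)
  case 0
  then show ?case using assms by (simp add: fun_eq_iff)
next
  case (Suc k)
  show ?case
    unfolding funpow.simps comp_def
    by (rule supported_pd[OF Suc]) (auto split: if_splits)
qed

lemma supported_mono: "supported Q f \<Longrightarrow> (\<And>ls. Q ls \<Longrightarrow> Q' ls) \<Longrightarrow> supported Q' f"
  unfolding supported_def by blast

context lie_nilpotent_ideal
begin

lemma filt_pd_power_mem: "f \<in> filt (Suc k) \<Longrightarrow> pd j ((pd b ^^ k) f) \<in> J"
proof (induction k arbitrary: f)
  case (Suc k)
  then have "pd b f \<in> filt (Suc k)" by simp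
  from Suc.IH[OF this] show ?case by (simp add: funpow_swap1)
qed simp

lemma invariant_harmonic_mem:
  assumes n: "CARD('n) \<ge> 2" and "p \<ge> 1"
    and u: "homogeneous i u" "inv_mod u" "lap u \<in> J" and i: "i > CARD('n) * (p - 1)"
  shows "u \<in> J"
proof (rule ccontr)
  assume "u \<notin> J"
  obtain k where k: "u \<notin> filt k" "u \<in> filt (Suc k)"
  proof -
    \<comment> \<open>The least filtration step gives the exact polynomial degree k, so that
      \<open>harmonic_filt\<close> can be used in contrapositive form.\<close>
    define K where "K = (LEAST k. u \<in> filt k)"
    have "u \<in> filt K" unfolding K_def by (rule LeastI[of "\<lambda>k. u \<in> filt k", OF homogeneous_filt[OF u(1)]])
    moreover from this obtain k where "K = Suc k" using \<open>u \<notin> J\<close> by (cases K) auto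
    moreover have "u \<notin> filt k" using not_less_Least[of k "\<lambda>k. u \<in> filt k"] \<open>K = Suc k\<close>
      by (simp add: K_def)
    ultimately show thesis using that by simp
  qed
  then obtain y where y: "y \<noteq> 0" "bilin y y = 0" "(dir y ^^ k) u \<notin> J"
    using harmonic_filt[OF n u(3)] by blast
  obtain a b :: 'n and g h :: "complex ^ 'n ^ 'n" and \<kappa>
    where "a \<noteq> b" and gh: "g ** h = mat 1" and hg: "h ** g = mat 1" and "\<kappa> \<noteq> 0"
      and h_row: "\<And>x. (h *v x) $ b = \<kappa> * bilin x y"
      and SO: "\<And>d. d a * d b = 1 \<Longrightarrow> (\<And>j. j \<noteq> a \<Longrightarrow> j \<noteq> b \<Longrightarrow> d j = 1) \<Longrightarrow> g ** diag d ** h \<in> SO"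
    using isotropic_basis[OF y(1,2)] by metis
  \<comment> \<open>The change of basis is applied to the element, not to the generators: the
    degrees of \<open>u\<close> in the adapted basis become ordinary multidegrees of
    \<open>f\<close>.\<close>
  define f where "f = act h u"
  have f_homogeneous: "homogeneous i f" and f_filt: "f \<in> filt (Suc k)"
    using homogeneous_act[OF u(1)] filt_act[OF k(2)] by (simp_all add: f_def)
  have pd_f: "pd b (act h v) = const \<kappa> * act h (dir y v)" for v
  proof -
    have "h $ b $ m = \<kappa> * y $ m" for m
      using h_row[of "axis m 1"] by (simp add: matrix_vector_mult_axis bilin_axis_left)
    then show ?thesis
      by (simp add: pd_act dir_def act_sum act_const_mult sum_distrib_left const_mult mult.assoc)
  qed
  have pd_power_f: "(pd b ^^ m) (act h v) = const (\<kappa> ^ m) * act h ((dir y ^^ m) v)" for m v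
    by (induction m) (simp_all add: pd_const_mult pd_f const_mult mult.assoc const_left_commute[of "const \<kappa>"])
  have "(pd b ^^ k) f \<notin> J"
  proof
    assume "(pd b ^^ k) f \<in> J"
    then have "act h ((dir y ^^ k) u) \<in> J"
      using \<open>\<kappa> \<noteq> 0\<close> const_mult_cancel[of "\<kappa> ^ k"] by (simp add: f_def pd_power_f)
    from act_mem[OF this, of g] show False using y(3) by (simp add: act_act gh act_mat_1)
  qed
  define \<Delta> where "\<Delta> = (count_list \<circ> letters) ` Poly_Mapping.keys f"
  define f' where "f' \<delta> = word_part (\<lambda>ls. count_list ls = \<delta>) f" for \<delta>
  have f_sum: "f = (\<Sum>\<delta>\<in>\<Delta>. f' \<delta>)" unfolding \<Delta>_def f'_def by (rule eq_sum_word_part)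
  have pd_power_sum: "(pd b ^^ k) (sum f' D) = (\<Sum>\<delta>\<in>D. (pd b ^^ k) (f' \<delta>))" for D
  proof -
    have "(pd b ^^ k) 0 = 0" by (induction k) simp_all
    then show ?thesis
      by (induction D rule: infinite_finite_induct) (simp_all add: pd_power_add)
  qed
  obtain \<delta> where \<delta>: "\<delta> \<in> \<Delta>" "(pd b ^^ k) (f' \<delta>) \<notin> J"
    using \<open>(pd b ^^ k) f \<notin> J\<close> f_sum pd_power_sum sum_mem by metis
  define e where "e = (pd b ^^ k) (f' \<delta>)"
  have "\<delta> a = \<delta> b"
  proof (rule ccontr)
    assume ne: "\<delta> a \<noteq> \<delta> b"
    \<comment> \<open>A single torus element is enough, since it acts on multidegree \<delta> by
      2^(\<delta> a - \<delta> b), which is 1 only if the two degrees agree. Its conjugate by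
      \<open>g\<close> fixes \<open>u\<close> modulo \<open>J\<close>; applying \<open>act h\<close>
      turns this into a statement about \<open>f\<close>.\<close>
    define d where "d j = (if j = a then 2 else if j = b then 1 / 2 else 1 :: complex)" for j
    have "g ** diag d ** h \<in> SO" using \<open>a \<noteq> b\<close> by (intro SO) (simp_all add: d_def)
    then have "act h (act (g ** diag d ** h) u - u) \<in> J"
      using u(2) act_mem by (simp add: inv_mod_def)
    also have "act h (act (g ** diag d ** h) u - u) = act (diag d) f - f"
      by (simp add: act_diff act_act f_def matrix_mul_assoc hg)
    finally have "word_part (\<lambda>ls. count_list ls = \<delta>) (act (diag d) f - f) \<in> J"
      by (rule word_part_mem) (simp_all add: add_mem lmult_mem act_mem)
    then have "const ((\<Prod>j\<in>UNIV. d j ^ \<delta> j) - 1) * f' \<delta> \<in> J"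
      by (simp add: word_part_diff word_part_act_diag f'_def const_diff left_diff_distrib)
    moreover have "(\<Prod>j\<in>UNIV. d j ^ \<delta> j) - 1 \<noteq> 0"
    proof -
      have "(\<Prod>j\<in>UNIV. d j ^ \<delta> j) = (\<Prod>j\<in>{a, b}. d j ^ \<delta> j)"
        by (intro prod.mono_neutral_right) (auto simp: d_def)
      also have "\<dots> = 2 ^ \<delta> a / 2 ^ \<delta> b"
        using \<open>a \<noteq> b\<close> by (simp add: d_def power_divide)
      finally have *: "(\<Prod>j\<in>UNIV. d j ^ \<delta> j) = complex_of_real (2 ^ \<delta> a / 2 ^ \<delta> b)" by simp
      have "(2 :: real) ^ \<delta> a \<noteq> 2 ^ \<delta> b" using ne by simp
      then have "(2 :: real) ^ \<delta> a / 2 ^ \<delta> b \<noteq> 1" by simp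
      then show ?thesis unfolding * by (metis eq_iff_diff_eq_0 of_real_1 of_real_eq_iff)
    qed
    ultimately have "f' \<delta> \<in> J" by (rule const_mult_cancel[rotated])
    then have "(pd b ^^ m) (f' \<delta>) \<in> J" for m by (induction m) (simp_all add: pd_mem)
    then show False using \<delta>(2) by blast
  qed
  have "f' \<delta> \<in> filt (Suc k)"
    unfolding f'_def using f_filt filt_add filt_const_mult filt_act by (rule word_part_mem)
  then have pd_e: "pd j e \<in> J" for j unfolding e_def by (rule filt_pd_power_mem)
  have e_supported: "supported (\<lambda>ls. \<forall>j. count_list ls j + (if j = b then k else 0) = \<delta> j) e"
    unfolding e_def f'_def by (intro supported_pd_power supported_word_part)
  have \<delta>_less: "\<delta> j < p" if "j \<noteq> b" for j
  proof (rule ccontr)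
    assume "\<not> \<delta> j < p"
    moreover have "supported (\<lambda>ls. count_list ls j = \<delta> j) e"
      by (rule supported_mono[OF e_supported]) (use that in \<open>auto split: if_splits\<close>)
    ultimately have "e \<in> J" using degree_bound[of j "\<delta> j" e] pd_e by simp
    then show False using \<delta>(2) by (simp add: e_def)
  qed
  \<comment> \<open>For \<open>j = b\<close> a bound on \<open>e\<close> would control only the
    degree left after k derivatives; the bound on \<delta> b comes from \<delta> a instead.\<close>
  then have "\<delta> j \<le> p - 1" for j
    using \<open>\<delta> a = \<delta> b\<close> \<open>a \<noteq> b\<close> by (cases "j = b") (metis Suc_pred' assms(2) less_Suc_eq_le less_le_trans zero_less_one)+
  then have "(\<Sum>j\<in>UNIV. \<delta> j) \<le> (\<Sum>j\<in>(UNIV :: 'n set). p - 1)" by (intro sum_mono)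
  moreover have "(\<Sum>j\<in>UNIV. \<delta> j) = i"
  proof -
    obtain w where w: "w \<in> Poly_Mapping.keys f" "\<delta> = count_list (letters w)"
      using \<delta>(1) by (auto simp: \<Delta>_def)
    then show ?thesis
      using f_homogeneous sum_count_set[of "letters w" UNIV] by (simp add: homogeneous_def)
  qed
  ultimately show False using i by simp
qed

text \<open>In one variable the algebra is commutative, so the degree bound applies with \<open>p = 1\<close>.\<close>

lemma invariant_harmonic_mem_1:
  assumes "CARD('n) = 1" and u: "homogeneous i u" "lap u \<in> J" and "i \<ge> 2"
  shows "u \<in> J"
proof -
  obtain j :: 'n where UNIV: "UNIV = {j}" using assms(1) by (auto simp: card_1_singleton_iff)
  have gen: "gen l * f = f * gen l" for l and f :: "'n free_algebra"
  proof (induction f rule: free_algebra_induct)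
    case (gen l' f)
    have "l = l'" using UNIV by (metis UNIV_I singletonD)
    with gen show ?case by (metis mult.assoc)
  qed (simp_all add: const_commute distrib_left distrib_right)
  have comm: "f * f' = f' * f" for f f' :: "'n free_algebra"
  proof (induction f rule: free_algebra_induct)
    case (gen l f)
    then show ?case by (metis \<open>\<And>f l. gen l * f = f * gen l\<close> mult.assoc)
  qed (simp_all add: const_commute distrib_left distrib_right)
  have "left_normed us \<in> J" if us: "length us = 1 + 1" for us
  proof -
    obtain v w where "us = [v, w]" using us by (auto simp: length_Suc_conv)
    then have "left_normed us = 0" using comm[of v w] by (simp add: left_normed_def commutator_def)
    then show ?thesis by (simp add: zero_mem)
  qed
  then interpret one: lie_nilpotent_ideal J 1
    by unfold_locales
  have count: "count_list ls j = length ls" for ls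
  proof -
    have "set ls \<subseteq> {j}" using UNIV by blast
    from sum_count_set[OF this] show ?thesis by simp
  qed
  \<comment> \<open>In one variable \<open>lap u\<close> is the second derivative, so the bound is
    applied first to \<open>pd j u\<close>, of degree \<open>i - 1 \<ge> 1\<close>, and then to
    \<open>u\<close>.\<close>
  have "pd j (pd j u) \<in> J" using u(2) unfolding lap_def UNIV by simp
  moreover have "Suc (i - 1) = i" "1 \<le> i - 1" "1 \<le> i" using \<open>i \<ge> 2\<close> by linarith+
  moreover from this have "homogeneous (i - 1) (pd j u)" using homogeneous_pd[of "i - 1" u j] u(1) by simp
  ultimately have "pd j u \<in> J"
    by (intro one.degree_bound[of j "i - 1" "pd j u"]) (simp_all only: count homogeneous_eq_supported)
  then show ?thesis
    using u(1) \<open>1 \<le> i\<close>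
    by (intro one.degree_bound[of j i u]) (simp_all only: count homogeneous_eq_supported)
qed

end

section \<open>Dimensions\<close>

context ring
begin

lemma dimension_zero_mem:
  assumes "dimension n K E" "K \<subseteq> carrier R" "\<zero> \<in> K"
  shows "E \<subseteq> carrier R \<and> \<zero> \<in> E"
  using assms
proof (induction rule: dimension.induct)
  case (Suc_dim v E n K)
  then have "\<zero> = \<zero> \<otimes> v \<oplus> \<zero>" by simp
  then have "\<zero> \<in> line_extension K v E"
    unfolding line_extension_mem_iff using Suc_dim by blast
  then show ?case using Suc_dim line_extension_in_carrier by blast
qed simp

lemma dimension_line_extension_mem:
  assumes "dimension n K E" "v \<in> carrier R" "K \<subseteq> carrier R" "\<zero> \<in> K" "\<one> \<in> K"
  shows "E \<subseteq> line_extension K v E \<and> v \<in> line_extension K v E"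
proof -
  have E: "E \<subseteq> carrier R" "\<zero> \<in> E" using dimension_zero_mem assms by blast+
  have "e = \<zero> \<otimes> v \<oplus> e" if "e \<in> E" for e using that E assms(2) by auto
  moreover have "v = \<one> \<otimes> v \<oplus> \<zero>" using assms(2) by simp
  ultimately show ?thesis unfolding subset_iff line_extension_mem_iff using E assms by metis
qed

lemma dimension_zero_iff:
  assumes "K \<subseteq> carrier R" "\<zero> \<in> K" "\<one> \<in> K"
  shows "dimension n K {\<zero>} \<longleftrightarrow> n = 0"
proof
  assume "dimension n K {\<zero>}"
  then show "n = 0"
  proof (cases rule: dimension.cases)
    case (Suc_dim v E m)
    have "v \<in> line_extension K v E" "\<zero> \<in> E"
      using dimension_line_extension_mem[OF Suc_dim(5,3)] dimension_zero_mem[OF Suc_dim(5)] assms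
      by blast+
    then have "v \<in> E" using Suc_dim(2) by (metis singletonD)
    then show ?thesis using Suc_dim(4) by blast
  qed
qed auto

text \<open>The domain \<open>A\<close> of the linear map stays fixed while the induction runs
  through the smaller spaces of the flag that witnesses the dimension of \<open>E\<close>.\<close>

lemma dimension_image:
  assumes K: "K \<subseteq> carrier R" "\<zero> \<in> K" "\<one> \<in> K"
    and A: "inj_on \<phi> A" "\<phi> ` A \<subseteq> carrier R" "\<phi> \<zero> = \<zero>"
    and linear: "\<And>k a b. k \<in> K \<Longrightarrow> a \<in> A \<Longrightarrow> b \<in> A \<Longrightarrow> \<phi> (k \<otimes> a \<oplus> b) = k \<otimes> \<phi> a \<oplus> \<phi> b"
    and "dimension n K E" "E \<subseteq> A"
  shows "dimension n K (\<phi> ` E)"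
  using assms(8,9,1-3) linear
proof (induction rule: dimension.induct)
  case (zero_dim K)
  then show ?case using A(3) by simp
next
  case (Suc_dim v E n K)
  have vE: "E \<subseteq> line_extension K v E" "v \<in> line_extension K v E"
    using dimension_line_extension_mem Suc_dim.hyps Suc_dim.prems by blast+
  then have vA: "v \<in> A" "E \<subseteq> A" using Suc_dim.prems(1) by blast+
  have "\<phi> ` line_extension K v E = line_extension K (\<phi> v) (\<phi> ` E)"
  proof (intro equalityI subsetI)
    fix x assume "x \<in> \<phi> ` line_extension K v E"
    then obtain u where "u \<in> line_extension K v E" "x = \<phi> u" by blast
    moreover from this obtain k e where "k \<in> K" "e \<in> E" "u = k \<otimes> v \<oplus> e"
      using line_extension_mem_iff by blast
    ultimately have "k \<in> K" "e \<in> E" "x = \<phi> (k \<otimes> v \<oplus> e)" by simp_all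
    then show "x \<in> line_extension K (\<phi> v) (\<phi> ` E)"
      unfolding line_extension_mem_iff using Suc_dim.prems(5) vA by blast
  next
    fix x assume "x \<in> line_extension K (\<phi> v) (\<phi> ` E)"
    then obtain k e where ke: "k \<in> K" "e \<in> E" "x = k \<otimes> \<phi> v \<oplus> \<phi> e"
      unfolding line_extension_mem_iff by blast
    then have "x = \<phi> (k \<otimes> v \<oplus> e)" using Suc_dim.prems(5) vA by auto
    then show "x \<in> \<phi> ` line_extension K v E"
      unfolding image_iff using ke line_extension_mem_iff by blast
  qed
  moreover have "\<phi> v \<notin> \<phi> ` E"
    using A(1) vA Suc_dim.hyps(2) by (auto dest: inj_onD)
  moreover have "\<phi> v \<in> carrier R" using A(2) vA by blast
  moreover have "dimension n K (\<phi> ` E)" using Suc_dim.IH Suc_dim.prems vA by blast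
  ultimately show ?case using dimension.Suc_dim by simp
qed

text \<open>Since \<open>dim\<close> is a definite description, it suffices that
  \<open>dimension n K\<close> holds for both spaces for the same n; existence of such an n does not
  have to be settled first.\<close>

lemma dim_eq_of_bij_betw:
  assumes K: "K \<subseteq> carrier R" "\<zero> \<in> K" "\<one> \<in> K"
    and \<phi>: "bij_betw \<phi> A B" "A \<subseteq> carrier R" "B \<subseteq> carrier R" "\<zero> \<in> A" "\<phi> \<zero> = \<zero>"
    and closed: "\<And>k a b. k \<in> K \<Longrightarrow> a \<in> A \<Longrightarrow> b \<in> A \<Longrightarrow> k \<otimes> a \<oplus> b \<in> A"
    and linear: "\<And>k a b. k \<in> K \<Longrightarrow> a \<in> A \<Longrightarrow> b \<in> A \<Longrightarrow> \<phi> (k \<otimes> a \<oplus> b) = k \<otimes> \<phi> a \<oplus> \<phi> b"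
  shows "dim K A = dim K B"
proof -
  have inj: "inj_on \<phi> A" and img: "\<phi> ` A = B" using \<phi>(1) by (auto simp: bij_betw_def)
  define \<psi> where "\<psi> = inv_into A \<phi>"
  have \<psi>\<phi>: "\<psi> (\<phi> a) = a" if "a \<in> A" for a using that inj by (simp add: \<psi>_def)
  have \<psi>: "bij_betw \<psi> B A" unfolding \<psi>_def by (rule bij_betw_inv_into[OF \<phi>(1)])
  have "dimension n K A \<longleftrightarrow> dimension n K B" for n
  proof
    assume "dimension n K A"
    from dimension_image[OF K inj _ \<phi>(5) linear this] show "dimension n K B"
      using img \<phi>(3) by simp
  next
    assume B: "dimension n K B"
    have "\<psi> (k \<otimes> a \<oplus> b) = k \<otimes> \<psi> a \<oplus> \<psi> b" if ab: "k \<in> K" "a \<in> B" "b \<in> B" for k a b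
    proof -
      obtain a' b' where "a' \<in> A" "b' \<in> A" "a = \<phi> a'" "b = \<phi> b'"
        using ab img by blast
      then show ?thesis using linear[OF ab(1), of a' b'] closed[OF ab(1)] \<psi>\<phi> by metis
    qed
    moreover have "\<psi> \<zero> = \<zero>" using \<psi>\<phi>[OF \<phi>(4)] \<phi>(5) by simp
    ultimately have "dimension n K (\<psi> ` B)"
      using dimension_image[OF K, of \<psi> B n B] B \<psi> \<phi>(2) unfolding bij_betw_def by blast
    then show "dimension n K A" using \<psi> unfolding bij_betw_def by simp
  qed
  then show ?thesis by (simp add: dim_def)
qed

end

section \<open>Cosets, invariants and the recursion for their dimensions\<close>

lemma lie_nilpotent_ideal_lie_ideal:
  "lie_nilpotent_ideal (lie_ideal (p + 1) :: 'n::finite free_algebra set) p"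
  by (intro lie_nilpotent_ideal.intro lie_nilpotent_ideal_axioms.intro invariant_ideal_lie_ideal
      left_normed_mem_lie_ideal) simp_all

lemma coset_eq: "coset p f = {h + f |h. h \<in> lie_ideal (p + 1)}"
  by (auto simp: coset_def a_r_coset_def' free_ring_def)

lemma mem_coset_iff: "g \<in> coset p f \<longleftrightarrow> g - f \<in> lie_ideal (p + 1)"
  unfolding coset_eq by (auto intro: exI[of _ "g - f"])

lemma coset_eq_iff: "coset p f = coset p g \<longleftrightarrow> f - g \<in> lie_ideal (p + 1)"
proof -
  interpret I: ring_ideal "lie_ideal (p + 1) :: 'a free_algebra set" by (rule ring_ideal_lie_ideal)
  have "f - g \<in> lie_ideal (p + 1)" if "coset p f = coset p g"
    using that mem_coset_iff[of f p f] I.zero_mem by (simp add: mem_coset_iff)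
  moreover have "h - f \<in> lie_ideal (p + 1) \<longleftrightarrow> h - g \<in> lie_ideal (p + 1)"
    if fg: "f - g \<in> lie_ideal (p + 1)" for h
    using I.add_mem[OF _ fg, of "h - f"] I.diff_mem[OF _ fg, of "h - g"] by (auto simp: algebra_simps)
  ultimately show ?thesis by (auto simp: mem_coset_iff)
qed

lemma ideal_lie_ideal: "ideal (lie_ideal m) (free_ring :: 'n free_algebra ring)"
  unfolding lie_ideal_def
  by (rule ring.genideal_ideal[OF ring_free_ring]) (simp add: free_ring_def)

lemma ring_rel_free: "ring (rel_free p)"
  unfolding rel_free_def by (rule ideal.quotient_is_ring[OF ideal_lie_ideal])

lemma coset_add: "coset p f \<oplus>\<^bsub>rel_free p\<^esub> coset p g = coset p (f + g)"
  and coset_mult: "coset p f \<otimes>\<^bsub>rel_free p\<^esub> coset p g = coset p (f * g)"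
  using ring_hom_add[OF ideal.rcos_ring_hom[OF ideal_lie_ideal], of f g]
    ring_hom_mult[OF ideal.rcos_ring_hom[OF ideal_lie_ideal], of f g]
  by (simp_all add: rel_free_def coset_def) (simp_all add: free_ring_def)

lemma coset_one: "\<one>\<^bsub>rel_free p\<^esub> = coset p 1"
  by (simp add: rel_free_def coset_def FactRing_def) (simp add: free_ring_def)

lemma carrier_rel_free: "carrier (rel_free p) = range (coset p)"
  by (auto simp: rel_free_def FactRing_def A_RCOSETS_def' coset_def) (auto simp: free_ring_def)

lemma coset_zero: "\<zero>\<^bsub>rel_free p\<^esub> = coset p 0"
proof -
  interpret R: ring "rel_free p :: 'a free_algebra set ring" by (rule ring_rel_free)
  have "coset p 0 \<oplus>\<^bsub>rel_free p\<^esub> coset p 0 = coset p (0 :: 'a free_algebra)" by (simp add: coset_add)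
  then show ?thesis by (metis R.add.r_cancel_one R.zero_closed carrier_rel_free rangeI)
qed

text \<open>Congruence of \<open>act A f\<close> and \<open>f\<close> gives only that the coset is
  mapped into itself. That it is mapped onto itself follows from the same inclusion for the inverse
  \<open>transpose A\<close>, which is in \<open>SO\<close> as well.\<close>

lemma coset_mem_invariants_iff:
  fixes f :: "'n::finite free_algebra"
  shows "coset p f \<in> invariants SO p \<longleftrightarrow> invariant_ideal.inv_mod (lie_ideal (p + 1)) f"
proof -
  let ?I = "lie_ideal (p + 1) :: 'n free_algebra set"
  interpret I: lie_nilpotent_ideal ?I p by (rule lie_nilpotent_ideal_lie_ideal)
  have f: "f \<in> coset p f" unfolding mem_coset_iff by (simp only: diff_self I.zero_mem)
  have subset: "act A ` coset p f \<subseteq> coset p f" if "I.inv_mod f" "A \<in> SO" for A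
  proof
    fix g assume "g \<in> act A ` coset p f"
    then obtain h where h: "h - f \<in> ?I" "g = act A h" by (auto simp only: mem_coset_iff)
    have "g - f = act A (h - f) + (act A f - f)" by (simp add: h(2) act_diff)
    also have "\<dots> \<in> ?I" using that h(1) I.act_mem I.add_mem by (simp only: I.inv_mod_def)
    finally show "g \<in> coset p f" by (simp only: mem_coset_iff)
  qed
  show ?thesis
  proof
    assume "coset p f \<in> invariants SO p"
    then have "act A f \<in> coset p f" if "A \<in> SO" for A using f that by (auto simp: invariants_def)
    then show "I.inv_mod f" unfolding I.inv_mod_def mem_coset_iff by blast
  next
    assume inv: "I.inv_mod f"
    have "act A ` coset p f = coset p f" if A: "A \<in> SO" for A
    proof
      show "coset p f \<subseteq> act A ` coset p f"
      proof
        fix g assume "g \<in> coset p f"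
        then have "act (transpose A) g \<in> coset p f" using subset[OF inv SO_transpose[OF A]] by blast
        moreover have "g = act A (act (transpose A) g)"
          using SO_transpose_mult[OF A] matrix_left_right_inverse[of A "transpose A"]
          by (simp add: act_act act_mat_1)
        ultimately show "g \<in> act A ` coset p f" by (rule rev_image_eqI)
      qed
    qed (rule subset[OF inv A])
    then show "coset p f \<in> invariants SO p" by (simp add: invariants_def carrier_rel_free)
  qed
qed

definition invariant_component :: "nat \<Rightarrow> nat \<Rightarrow> 'n::finite free_algebra set set"
  where "invariant_component p i = component p i \<inter> invariants SO p"

lemma invariant_component_eq:
  "(invariant_component p i :: 'n::finite free_algebra set set)
    = coset p ` {f. homogeneous i f \<and> invariant_ideal.inv_mod (lie_ideal (p + 1)) f}"
  by (auto simp: invariant_component_def component_def coset_mem_invariants_iff simp del: add_Suc_right One_nat_def)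

lemma scalars_props:
  "scalars p \<subseteq> carrier (rel_free p)" "\<zero>\<^bsub>rel_free p\<^esub> \<in> scalars p" "\<one>\<^bsub>rel_free p\<^esub> \<in> scalars p"
proof -
  show "scalars p \<subseteq> carrier (rel_free p)" by (auto simp: scalars_def carrier_rel_free)
  have "coset p (const c) \<in> scalars p" for c by (simp add: scalars_def)
  from this[of 0] this[of 1] show
    "\<zero>\<^bsub>rel_free p\<^esub> \<in> scalars p" "\<one>\<^bsub>rel_free p\<^esub> \<in> scalars p"
    by (simp_all add: coset_zero coset_one)
qed

lemma dim_invariant_component:
  assumes "p \<ge> 1" "\<not> (CARD('n::finite) = 1 \<and> p = 1)" "Suc (Suc i) > CARD('n) * (p - 1)"
  shows "ring.dim (rel_free p) (scalars p) (invariant_component p (Suc (Suc i)) :: 'n free_algebra set set)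
    = ring.dim (rel_free p) (scalars p) (invariant_component p i :: 'n free_algebra set set)"
proof -
  let ?I = "lie_ideal (p + 1) :: 'n free_algebra set"
  interpret I: lie_nilpotent_ideal ?I p by (rule lie_nilpotent_ideal_lie_ideal)
  interpret R: ring "rel_free p :: 'n free_algebra set ring" by (rule ring_rel_free)
  let ?E = "\<lambda>i. invariant_component p i :: 'n free_algebra set set"
  \<comment> \<open>With a single variable there is no isotropic vector, and the commutative
    argument takes over; it needs only degree at least 2.\<close>
  have injective: "f \<in> ?I" if "homogeneous (Suc (Suc i)) f" "I.inv_mod f" "lap f \<in> ?I" for f
  proof (cases "CARD('n) = 1")
    case True
    then show ?thesis using I.invariant_harmonic_mem_1[OF _ that(1,3)] by simp
  next
    case False
    then have "CARD('n) \<ge> 2" using zero_less_card_finite[where 'a = 'n] by linarith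
    from I.invariant_harmonic_mem[OF this assms(1) that assms(3)] show ?thesis .
  qed
  \<comment> \<open>The Laplacian on cosets, through a chosen representative; the choice does not
    matter because \<open>lap\<close> preserves the ideal.\<close>
  define \<phi> where "\<phi> C = coset p (lap (SOME f. f \<in> C))" for C :: "'n free_algebra set"
  have \<phi>: "\<phi> (coset p f) = coset p (lap f)" for f
  proof -
    have "f \<in> coset p f" unfolding mem_coset_iff by (simp only: diff_self I.zero_mem)
    then have "(SOME g. g \<in> coset p f) \<in> coset p f" by (rule someI)
    then have "lap ((SOME g. g \<in> coset p f) - f) \<in> ?I" unfolding mem_coset_iff by (rule I.lap_mem)
    then show ?thesis by (simp only: \<phi>_def coset_eq_iff lap_diff)
  qed
  have linear: "\<phi> (k \<otimes>\<^bsub>rel_free p\<^esub> a \<oplus>\<^bsub>rel_free p\<^esub> b) = k \<otimes>\<^bsub>rel_free p\<^esub> \<phi> a \<oplus>\<^bsub>rel_free p\<^esub> \<phi> b"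
    if kab: "k \<in> scalars p" "a \<in> ?E m" "b \<in> ?E m" for k a b m
  proof -
    obtain c f g where "k = coset p (const c)" "a = coset p f" "b = coset p g"
      using kab unfolding scalars_def invariant_component_eq by blast
    then show ?thesis by (simp add: coset_add coset_mult \<phi> lap_add lap_const_mult)
  qed
  have closed: "k \<otimes>\<^bsub>rel_free p\<^esub> a \<oplus>\<^bsub>rel_free p\<^esub> b \<in> ?E m"
    if kab: "k \<in> scalars p" "a \<in> ?E m" "b \<in> ?E m" for k a b m
  proof -
    obtain c f g where kfg: "k = coset p (const c)" "a = coset p f" "b = coset p g"
      "homogeneous m f" "homogeneous m g" "I.inv_mod f" "I.inv_mod g"
      using kab unfolding scalars_def invariant_component_eq by blast
    have "homogeneous m (const c * f + g)"
      by (intro homogeneous_add homogeneous_const_mult kfg)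
    moreover have "I.inv_mod (const c * f + g)"
      by (rule I.inv_mod_add[OF I.inv_mod_mult[OF I.inv_mod_const kfg(6)] kfg(7)])
    ultimately show ?thesis
      unfolding invariant_component_eq kfg(1-3) coset_mult coset_add by blast
  qed
  have "inj_on \<phi> (?E (Suc (Suc i)))"
  proof (rule inj_onI)
    fix C D assume "C \<in> ?E (Suc (Suc i))" "D \<in> ?E (Suc (Suc i))" and eq: "\<phi> C = \<phi> D"
    then obtain f g where fg: "C = coset p f" "D = coset p g"
      "homogeneous (Suc (Suc i)) f" "homogeneous (Suc (Suc i)) g" "I.inv_mod f" "I.inv_mod g"
      unfolding invariant_component_eq by blast
    have lap: "lap (f - g) \<in> ?I" using eq by (simp only: fg \<phi> coset_eq_iff lap_diff)
    have "f - g \<in> ?I"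
      by (rule injective[OF homogeneous_diff[OF fg(3,4)] I.inv_mod_diff[OF fg(5,6)] lap])
    then show "C = D" by (simp only: fg coset_eq_iff)
  qed
  moreover have "\<phi> ` ?E (Suc (Suc i)) = ?E i"
  proof (intro equalityI subsetI)
    fix C assume "C \<in> \<phi> ` ?E (Suc (Suc i))"
    then obtain f where "C = coset p (lap f)" "homogeneous (Suc (Suc i)) f" "I.inv_mod f"
      unfolding invariant_component_eq using \<phi> by auto
    then show "C \<in> ?E i" unfolding invariant_component_eq using homogeneous_lap I.inv_mod_lap by blast
  next
    fix C assume "C \<in> ?E i"
    then obtain f where f: "C = coset p f" "homogeneous i f" "I.inv_mod f"
      unfolding invariant_component_eq by blast
    from I.lap_surj[OF f(2,3)] obtain g where g: "homogeneous (Suc (Suc i)) g" "I.inv_mod g"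
      "lap g - f \<in> ?I" by blast
    then have "C = \<phi> (coset p g)" by (simp only: f(1) \<phi>) (metis coset_eq_iff)
    then show "C \<in> \<phi> ` ?E (Suc (Suc i))" unfolding invariant_component_eq using g(1,2) by blast
  qed
  ultimately have "bij_betw \<phi> (?E (Suc (Suc i))) (?E i)" by (simp add: bij_betw_def)
  moreover have "?E m \<subseteq> carrier (rel_free p)" for m
    unfolding invariant_component_eq carrier_rel_free by blast
  moreover have "\<zero>\<^bsub>rel_free p\<^esub> \<in> ?E m" for m
    unfolding invariant_component_eq coset_zero using I.inv_mod_const[of 0] by (intro imageI) simp
  moreover have "\<phi> \<zero>\<^bsub>rel_free p\<^esub> = \<zero>\<^bsub>rel_free p\<^esub>" unfolding coset_zero \<phi> by (simp add: lap_def)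
  ultimately show ?thesis
    using R.dim_eq_of_bij_betw[OF scalars_props, of \<phi> "?E (Suc (Suc i))" "?E i"] linear closed by blast
qed

text \<open>For p = 1 the bound n (p - 1) is 0, so degree 1 must contribute nothing, but it is not
  reached by the recursion from i to i - 2. Linear elements are harmonic for degree reasons, and the
  vanishing of harmonic invariants above the bound applies directly.\<close>

lemma dim_invariant_component_1:
  assumes "CARD('n::finite) \<ge> 2"
  shows "ring.dim (rel_free 1) (scalars 1) (invariant_component 1 1 :: 'n free_algebra set set) = 0"
proof -
  let ?I = "lie_ideal (1 + 1) :: 'n free_algebra set"
  interpret I: lie_nilpotent_ideal ?I 1 by (rule lie_nilpotent_ideal_lie_ideal)
  interpret R: ring "rel_free 1 :: 'n free_algebra set ring" by (rule ring_rel_free)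
  have "f \<in> ?I" if "homogeneous 1 f" "I.inv_mod f" for f
    by (rule I.invariant_harmonic_mem[OF assms _ that]) (use lap_eq_0[OF that(1)] I.zero_mem in simp_all)
  then have "coset 1 f = coset 1 0" if "homogeneous 1 f" "I.inv_mod f" for f
    using that by (simp only: coset_eq_iff diff_zero)
  moreover have "homogeneous 1 0" "I.inv_mod 0" using I.inv_mod_const[of 0] by simp_all
  ultimately have "(invariant_component 1 1 :: 'n free_algebra set set) = {\<zero>\<^bsub>rel_free 1\<^esub>}"
    unfolding invariant_component_eq coset_zero by blast
  then show ?thesis
    unfolding R.dim_def by (simp only: R.dimension_zero_iff[OF scalars_props] the_eq_trivial)
qed

text \<open>The coefficients of \<open>F * (1 - fps_X ^ 2)\<close> are the differences of
  coefficients of \<open>F\<close> two places apart, and the coefficient itself at 0 and 1. Index 1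
  exceeds \<open>N\<close> only for \<open>N = 0\<close>, hence the second assumption.\<close>

lemma fps_eq_poly_divide:
  fixes F :: "'a::field fps"
  assumes "\<And>i. i > N \<Longrightarrow> i \<ge> 2 \<Longrightarrow> fps_nth F i = fps_nth F (i - 2)"
    and "N < 1 \<Longrightarrow> fps_nth F 1 = 0"
  shows "\<exists>q. degree q \<le> N \<and> F = fps_of_poly q / (1 - fps_X ^ 2)"
proof -
  define G where "G = F * (1 - fps_X ^ 2)"
  have G: "fps_nth G i = fps_nth F i - (if i < 2 then 0 else fps_nth F (i - 2))" for i
    by (simp add: G_def right_diff_distrib fps_X_power_mult_right_nth)
  have G0: "fps_nth G i = 0" if "i > N" for i
    using assms(1)[OF that] assms(2) that unfolding G by (cases "i < 2") (auto simp: less_2_cases_iff)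
  define q where "q = (\<Sum>i\<le>N. Polynomial.monom (fps_nth G i) i)"
  have q: "Polynomial.coeff q i = fps_nth G i" for i
    by (simp add: q_def coeff_sum G0)
  have "degree q \<le> N" by (rule degree_le) (simp add: q G0)
  moreover have "fps_of_poly q = G" by (rule fps_ext) (simp add: q)
  moreover have "(1 - fps_X ^ 2 :: 'a fps) \<noteq> 0"
  proof
    assume "(1 - fps_X ^ 2 :: 'a fps) = 0"
    then have "fps_nth (1 - fps_X ^ 2 :: 'a fps) 0 = fps_nth 0 0" by (rule arg_cong)
    then show False by simp
  qed
  then have "F = G / (1 - fps_X ^ 2)" by (simp add: G_def)
  ultimately show ?thesis by blast
qed

text \<open>The case n = p = 1 is a genuine exception: the group is trivial, the algebra is the
  polynomial ring in one variable, and its series 1 / (1 - t) = (1 + t) / (1 - t^2) has a numerator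
  of degree 1 > 0.\<close>

theorem proposition4p3:
  fixes p :: nat
  assumes "p \<ge> 1"
    and "\<not> (CARD('n::finite) = 1 \<and> p = 1)"
  shows "\<exists>q :: rat poly. degree q \<le> CARD('n) * (p - 1) \<and>
    hilbert_series (SO :: (complex ^ 'n ^ 'n) set) p = fps_of_poly q / (1 - fps_X ^ 2)"
proof (rule fps_eq_poly_divide)
  have nth: "fps_nth (hilbert_series (SO :: (complex ^ 'n ^ 'n) set) p) i
      = of_nat (ring.dim (rel_free p) (scalars p) (invariant_component p i :: 'n free_algebra set set))" for i
    by (simp add: hilbert_series_def invariant_component_def)
  show "fps_nth (hilbert_series (SO :: (complex ^ 'n ^ 'n) set) p) i
      = fps_nth (hilbert_series (SO :: (complex ^ 'n ^ 'n) set) p) (i - 2)"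
    if "i > CARD('n) * (p - 1)" "i \<ge> 2" for i
  proof -
    have "i = Suc (Suc (i - 2))" using that(2) by simp
    then show ?thesis
      using dim_invariant_component[OF assms, of "i - 2"] that(1) unfolding nth by metis
  qed
  show "fps_nth (hilbert_series (SO :: (complex ^ 'n ^ 'n) set) p) 1 = 0" if "CARD('n) * (p - 1) < 1"
  proof -
    have "p = 1" using that assms(1) zero_less_card_finite[where 'a = 'n] by (cases "p - 1") auto
    then have "CARD('n) \<ge> 2" using assms(2) zero_less_card_finite[where 'a = 'n] by linarith
    from dim_invariant_component_1[OF this] show ?thesis using \<open>p = 1\<close> unfolding nth by simp
  qed
qed

end
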